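(* A finite local principal ideal ring $R$ with $a>e$ is determined up to isomorphism by its signature $(a,e,f,p,\Delta)$. That is: let $R$ and $R'$ be finite local principal ideal rings of the same type $(a,e,f,p)$ with $a>e$, with coefficient rings $R_\omega$ and $R'_\omega$ and invariants $\Delta\subseteq R_\omega[Y]$ and $\Delta'\subseteq R'_\omega[Y]$ respectively. If there is a ring isomorphism $\sigma:R_\omega\to R'_\omega$ whose coefficientwise extension $R_\omega[Y]\to R'_\omega[Y]$ maps $\Delta$ onto $\Delta'$, then $R\cong R'$ as rings.
   Context: All rings are commutative with 1. For a finite local principal ideal ring $R$ with maximal ideal $\mathfrak{p}$: $k=R/\mathfrak{p}$, $p=\mathrm{char}(k)$, $f=[k:\mathbb{F}_p]$; $a$ is the least positive integer with $\mathfrak{p}^a=0$; for $0\ne r\in R$, $\mathrm{ord}_{\mathfrak{p}}(r)=n$ iff $r\in\mathfrak{p}^n\setminus\mathfrak{p}^{n+1}$, and $\mathrm{ord}_{\mathfrak{p}}(0)=a$; $e=\mathrm{ord}_{\mathfrak{p}}(p)$. The type of $R$ is $(a,e,f,p)$. Put $\rho=\{r\in R\mid r^{p^f}=r\}$. The coefficient ring $R_\omega$ of $R$ is the subring of $R$ generated by $\rho$. It is itself a finite local principal ideal ring with maximal ideal $pR_\omega$, and up to isomorphism it depends only on $\lceil a/e\rceil$, $f$ and $p$. For $a>e$, $\nabla$ is the set of $p$-Eisenstein polynomials of degree $e$ over $R_\omega$: monic $q\in R_\omega[Y]$ of degree $e$ with all non-leading coefficients in $pR_\omega$ and constant term in $pR_\omega\setminus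 p^2R_\omega$. The invariant $\Delta$ of $R$ is $\Delta=\{q\in\nabla\mid q\text{ has a zero in }R\}$. The signature of $R$ is $(a,e,f,p,\Delta)$. *)

theory Defs
  imports "HOL-Algebra.Algebra"
begin

locale finite_local_pir = cring +
  assumes finite_carrier: "finite (carrier R)"
    and local: "\<exists>!P. maximalideal P R"
    and principal: "\<And>I. ideal I R \<Longrightarrow> principalideal I R"

definition max_ideal :: "('a, 'm) ring_scheme \<Rightarrow> 'a set"
  where "max_ideal R = (THE P. maximalideal P R)"

definition residue_field :: "('a, 'm) ring_scheme \<Rightarrow> 'a set ring"
  where "residue_field R = R Quot (max_ideal R)"

primrec ideal_power :: "('a, 'm) ring_scheme \<Rightarrow> 'a set \<Rightarrow> nat \<Rightarrow> 'a set"
  where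
    "ideal_power R I 0 = carrier R"
  | "ideal_power R I (Suc n) = I \<cdot>\<^bsub>R\<^esub> ideal_power R I n"

definition ring_characteristic :: "('a, 'm) ring_scheme \<Rightarrow> nat"
  where "ring_characteristic R =
    (if \<exists>n::nat. 0 < n \<and> [n] \<cdot>\<^bsub>R\<^esub> \<one>\<^bsub>R\<^esub> = \<zero>\<^bsub>R\<^esub>
     then LEAST n::nat. 0 < n \<and> [n] \<cdot>\<^bsub>R\<^esub> \<one>\<^bsub>R\<^esub> = \<zero>\<^bsub>R\<^esub> else 0)"

definition residue_char :: "('a, 'm) ring_scheme \<Rightarrow> nat"
  where "residue_char R = ring_characteristic (residue_field R)"

text \<open>The field generated by the empty set is the prime subfield, i.e. the copy of the field
  with \<open>p\<close> elements inside the residue field.\<close>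

definition residue_degree :: "('a, 'm) ring_scheme \<Rightarrow> nat"
  where "residue_degree R =
    ring.dim (residue_field R) (generate_field (residue_field R) {}) (carrier (residue_field R))"

definition nilpotency_index :: "('a, 'm) ring_scheme \<Rightarrow> nat"
  where "nilpotency_index R =
    (LEAST n. 0 < n \<and> ideal_power R (max_ideal R) n = {\<zero>\<^bsub>R\<^esub>})"

definition ord_max :: "('a, 'm) ring_scheme \<Rightarrow> 'a \<Rightarrow> nat"
  where "ord_max R r =
    (if r = \<zero>\<^bsub>R\<^esub> then nilpotency_index R
     else THE n. r \<in> ideal_power R (max_ideal R) n - ideal_power R (max_ideal R) (Suc n))"

definition char_elem :: "('a, 'm) ring_scheme \<Rightarrow> 'a"
  where "char_elem R = [residue_char R] \<cdot>\<^bsub>R\<^esub> \<one>\<^bsub>R\<^esub>"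

definition ram_index :: "('a, 'm) ring_scheme \<Rightarrow> nat"
  where "ram_index R = ord_max R (char_elem R)"

definition lpir_type :: "('a, 'm) ring_scheme \<Rightarrow> nat \<times> nat \<times> nat \<times> nat"
  where "lpir_type R = (nilpotency_index R, ram_index R, residue_degree R, residue_char R)"

definition rho :: "('a, 'm) ring_scheme \<Rightarrow> 'a set"
  where "rho R = {r \<in> carrier R. r [^]\<^bsub>R\<^esub> (residue_char R ^ residue_degree R) = r}"

definition coeff_ring :: "('a, 'm) ring_scheme \<Rightarrow> ('a, 'm) ring_scheme"
  where "coeff_ring R = R\<lparr>carrier := generate_ring R (rho R)\<rparr>"

text \<open>Polynomials are lists of coefficients, leading coefficient first. Both principal ideals
  below are taken in the coefficient ring, not in \<open>R\<close>.\<close>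

definition eisenstein_polys :: "('a, 'm) ring_scheme \<Rightarrow> 'a list set"
  where "eisenstein_polys R =
    {q \<in> carrier ((carrier (coeff_ring R)) [X]\<^bsub>R\<^esub>).
       degree q = ram_index R \<and>
       ring.coeff R q (ram_index R) = \<one>\<^bsub>R\<^esub> \<and>
       (\<forall>i < ram_index R. ring.coeff R q i \<in> PIdl\<^bsub>coeff_ring R\<^esub> (char_elem R)) \<and>
       ring.coeff R q 0 \<in> PIdl\<^bsub>coeff_ring R\<^esub> (char_elem R)
                          - PIdl\<^bsub>coeff_ring R\<^esub> (char_elem R [^]\<^bsub>R\<^esub> (2::nat))}"

definition Delta :: "('a, 'm) ring_scheme \<Rightarrow> 'a list set"
  where "Delta R =
    {q \<in> eisenstein_polys R. \<exists>x \<in> carrier R. ring.eval R q x = \<zero>\<^bsub>R\<^esub>}"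

end

theory Submission
  imports Defs
begin

text \<open>
  Let \<open>\<pi>\<close> generate the maximal ideal of \<open>R\<close> and let \<open>K\<close> be the coefficient ring. The fixed points
  of \<open>r \<mapsto> r\<^sup>q\<close>, with \<open>q\<close> the size of the residue field, meet every residue class, and \<open>p\<close> is a unit
  times \<open>\<pi>\<^sup>e\<close>; successive approximation therefore writes every element of \<open>R\<close> as the value at \<open>\<pi>\<close> of
  a polynomial over \<open>K\<close> of degree below \<open>e\<close> (lemma \<open>eval_span_uniformizer\<close>). Expanding the unit
  \<open>v\<close> with \<open>\<pi>\<^sup>e = p v\<close> in this way produces an Eisenstein polynomial with zero \<open>\<pi>\<close>
  (\<open>uniformizer_eisenstein_root\<close>). Its image under \<open>\<sigma>\<close> lies in the other invariant, so it has a
  zero \<open>\<pi>'\<close> in \<open>R'\<close>, and a zero of an Eisenstein polynomial always generates the maximal ideal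
  (\<open>eisenstein_root_uniformizer\<close>).

  The isomorphism sends \<open>g(\<pi>)\<close> to \<open>(\<sigma> g)(\<pi>')\<close>. To see that this is well defined and injective,
  its graph is studied inside the product ring \<open>R \<times> R'\<close>: it is the set \<open>T\<close> of values at the pair
  \<open>(\<pi>, \<pi>')\<close> of polynomials of degree below \<open>e\<close> whose coefficients lie in the graph of \<open>\<sigma>\<close>. Since the
  pair is a zero of a monic polynomial of degree \<open>e\<close> over the graph of \<open>\<sigma>\<close>, the set \<open>T\<close> is a subring
  (\<open>eval_span_subring\<close>). Every element of \<open>K\<close> is a unit times a power of \<open>p\<close>
  (\<open>coeff_unit_times_char_power\<close>), and \<open>\<sigma>\<close> respects this, so every coefficient is a unit times a
  power of \<open>(\<pi>, \<pi>')\<close> with exponent divisible by \<open>e\<close>. The terms of a polynomial of degree below \<open>e\<close>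
  then have exponents in different classes modulo \<open>e\<close>, the term of least exponent dominates, and
  every nonzero element of \<open>T\<close> is a unit times a power of \<open>(\<pi>, \<pi>')\<close>
  (\<open>eval_span_unit_times_power\<close>). Finally \<open>\<pi>\<^sup>n\<close> and \<open>\<pi>'\<^sup>n\<close> vanish for the same \<open>n\<close>, namely
  for \<open>n \<ge> a\<close>, so one component of an element of \<open>T\<close> vanishes if and only if the other does, which
  makes \<open>T\<close> the graph of an isomorphism (\<open>iso_of_graph\<close>).
\<close>

section \<open>Finite local principal ideal rings\<close>

lemma (in cring) PIdl_mem_iff:
  "x \<in> PIdl a \<longleftrightarrow> (\<exists>r\<in>carrier R. x = r \<otimes> a)"
  unfolding cgenideal_def by auto

lemma (in cring) ideal_prod_PIdl:
  assumes "a \<in> carrier R" "b \<in> carrier R"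
  shows "(PIdl a) \<cdot> (PIdl b) = PIdl (a \<otimes> b)"
proof
  show "(PIdl a) \<cdot> (PIdl b) \<subseteq> PIdl (a \<otimes> b)"
  proof
    fix x assume "x \<in> (PIdl a) \<cdot> (PIdl b)"
    then show "x \<in> PIdl (a \<otimes> b)"
    proof (induction rule: ideal_prod.induct)
      case (prod i j)
      then obtain r s where "r \<in> carrier R" "s \<in> carrier R" "i = r \<otimes> a" "j = s \<otimes> b"
        by (auto simp: PIdl_mem_iff)
      then have "i \<otimes> j = (r \<otimes> s) \<otimes> (a \<otimes> b)" "r \<otimes> s \<in> carrier R"
        using assms by (simp_all add: m_ac)
      then show ?case by (auto simp: PIdl_mem_iff)
    next
      case (sum s1 s2)
      then show ?case
        using cgenideal_ideal[of "a \<otimes> b"] assms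
        by (meson additive_subgroup.a_closed ideal.axioms(1) m_closed)
    qed
  qed
  show "PIdl (a \<otimes> b) \<subseteq> (PIdl a) \<cdot> (PIdl b)"
  proof
    fix x assume "x \<in> PIdl (a \<otimes> b)"
    then obtain r where "r \<in> carrier R" "x = (r \<otimes> a) \<otimes> b"
      using assms by (auto simp: PIdl_mem_iff m_assoc)
    moreover have "r \<otimes> a \<in> PIdl a" "b \<in> PIdl b"
      using \<open>r \<in> carrier R\<close> assms cgenideal_self by (auto simp: PIdl_mem_iff)
    ultimately show "x \<in> (PIdl a) \<cdot> (PIdl b)"
      by (simp add: ideal_prod.prod)
  qed
qed

text \<open>
  Among the finitely many proper ideals that contain \<open>x\<close>, one that is maximal for inclusion is
  a maximal ideal.
\<close>

lemma (in cring) nonunit_in_maximal: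
  assumes "finite (carrier R)" and x: "x \<in> carrier R" "x \<notin> Units R"
  shows "\<exists>M. maximalideal M R \<and> x \<in> M"
proof -
  define F where "F = {I. ideal I R \<and> \<one> \<notin> I \<and> x \<in> I}"
  have F_sub: "F \<subseteq> Pow (carrier R)"
    unfolding F_def by (auto dest: ideal.Icarr)
  have finF: "finite F"
    by (rule finite_subset[OF F_sub]) (simp add: assms(1))
  have "\<one> \<notin> PIdl x"
    using x by (auto simp: PIdl_mem_iff Units_def m_comm)
  then have "PIdl x \<in> F"
    unfolding F_def using x cgenideal_ideal cgenideal_self by auto
  then obtain M where M: "M \<in> F" "\<And>I. I \<in> F \<Longrightarrow> M \<subseteq> I \<Longrightarrow> I = M"
    using finite_has_maximal2[OF finF] by metis
  have "maximalideal M R"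
  proof (rule maximalidealI)
    show "ideal M R" using M(1) F_def by auto
    show "carrier R \<noteq> M" using M(1) F_def by auto
    show "J = M \<or> J = carrier R" if "ideal J R" "M \<subseteq> J" "J \<subseteq> carrier R" for J
    proof (cases "\<one> \<in> J")
      case True
      then show ?thesis using ideal.one_imp_carrier that by metis
    next
      case False
      then show ?thesis using M that unfolding F_def by auto
    qed
  qed
  then show ?thesis using M(1) F_def by auto
qed

definition uniformizer :: "('a, 'm) ring_scheme \<Rightarrow> 'a \<Rightarrow> bool"
  where "uniformizer R x \<longleftrightarrow> x \<in> carrier R \<and> max_ideal R = PIdl\<^bsub>R\<^esub> x"

context finite_local_pir
begin

lemma max_ideal_maximal: "maximalideal (max_ideal R) R"
  unfolding max_ideal_def using local by (rule theI')

lemma max_ideal_ideal: "ideal (max_ideal R) R"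
  using max_ideal_maximal by (simp add: maximalideal_def)

lemma max_ideal_carrier: "x \<in> max_ideal R \<Longrightarrow> x \<in> carrier R"
  using max_ideal_ideal by (rule ideal.Icarr)

lemma Units_iff_notin_max: "x \<in> Units R \<longleftrightarrow> x \<in> carrier R \<and> x \<notin> max_ideal R"
proof -
  interpret maximalideal "max_ideal R" R by (rule max_ideal_maximal)
  have "x \<notin> max_ideal R" if "x \<in> Units R"
  proof
    assume "x \<in> max_ideal R"
    then have "inv x \<otimes> x \<in> max_ideal R" using that by (intro I_l_closed) auto
    then have "\<one> \<in> max_ideal R" using Units_l_inv[OF that] by metis
    then show False using I_notcarr one_imp_carrier by auto
  qed
  moreover have "x \<in> max_ideal R" if "x \<in> carrier R" "x \<notin> Units R"
    using nonunit_in_maximal[OF finite_carrier that] local max_ideal_maximal by metis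
  ultimately show ?thesis by auto
qed

lemma one_neq_zero: "\<one> \<noteq> \<zero>"
    using Units_iff_notin_max[of \<one>] ideal.axioms(1)[OF max_ideal_ideal] additive_subgroup.zero_closed
    by (metis Units_one_closed)

lemma Units_plus_max_ideal: "m \<in> max_ideal R \<Longrightarrow> u \<in> Units R \<Longrightarrow> u \<oplus> m \<in> Units R"
proof -
  assume m: "m \<in> max_ideal R" and u: "u \<in> Units R"
  interpret ideal "max_ideal R" R by (rule max_ideal_ideal)
  have c: "u \<in> carrier R" "m \<in> carrier R" using m u max_ideal_carrier by auto
  have "u = (u \<oplus> m) \<ominus> m" using c by algebra
  then have "u \<oplus> m \<notin> max_ideal R"
    using m u Units_iff_notin_max a_minus_def a_closed a_inv_closed by metis
  then show ?thesis using Units_iff_notin_max c by auto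
qed

lemma uniformizer_ex: "\<exists>x. uniformizer R x"
proof -
  obtain x where "x \<in> carrier R" "max_ideal R = Idl {x}"
    using principalideal.generate[OF principal[OF max_ideal_ideal]] by auto
  then show ?thesis using cgenideal_eq_genideal unfolding uniformizer_def by auto
qed

lemma max_ideal_mem_iff:
  "uniformizer R \<pi> \<Longrightarrow> x \<in> max_ideal R \<longleftrightarrow> (\<exists>r\<in>carrier R. x = r \<otimes> \<pi>)"
  unfolding uniformizer_def by (simp add: PIdl_mem_iff)

lemma ideal_power_uniformizer:
  assumes "uniformizer R \<pi>"
  shows "ideal_power R (max_ideal R) n = PIdl (\<pi> [^] n)"
proof (induction n)
  case 0
  show ?case by (auto simp: PIdl_mem_iff)
next
  case (Suc n)
  then show ?case
    using assms ideal_prod_PIdl[of \<pi> "\<pi> [^] n"]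
    by (simp add: uniformizer_def m_comm)
qed

text \<open>
  By finiteness two powers \<open>\<pi>\<^sup>m\<close> and \<open>\<pi>\<^sup>k\<close> with \<open>m < k\<close> agree, and \<open>1 - \<pi>\<^sup>k\<^sup>-\<^sup>m\<close> is a unit that
  annihilates \<open>\<pi>\<^sup>m\<close>.
\<close>

lemma max_ideal_nilpotent:
  assumes "uniformizer R \<pi>"
  shows "\<exists>n. \<pi> [^] (n::nat) = \<zero>"
proof -
  have c: "\<pi> \<in> carrier R" using assms uniformizer_def by metis
  have "\<not> inj (\<lambda>n::nat. \<pi> [^] n)"
    using c finite_carrier finite_subset[of "range (\<lambda>n::nat. \<pi> [^] n)" "carrier R"]
      finite_imageD infinite_UNIV_nat by blast
  then obtain m k :: nat where mk: "m < k" "\<pi> [^] m = \<pi> [^] k"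
    unfolding inj_def by (metis linorder_neqE_nat)
  have *: "\<pi> [^] k = \<pi> [^] m \<otimes> \<pi> [^] (k - m)"
    using mk(1) nat_pow_mult[OF c, of m "k - m"] by simp
  have "\<pi> [^] (k - m) = \<pi> [^] (k - m - 1) \<otimes> \<pi>"
    using mk(1) nat_pow_Suc[of \<pi> "k - m - 1"] by (simp only: Suc_diff_Suc Suc_diff_1 zero_less_diff)
  then have "\<pi> [^] (k - m) \<in> max_ideal R"
    using max_ideal_mem_iff[OF assms] c by blast
  then have "\<ominus> (\<pi> [^] (k - m)) \<in> max_ideal R"
    by (metis ideal.axioms(1) max_ideal_ideal additive_subgroup.a_inv_closed)
  then have u: "\<one> \<ominus> \<pi> [^] (k - m) \<in> Units R"
    unfolding a_minus_def using Units_plus_max_ideal by blast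
  have "\<pi> [^] m \<otimes> (\<one> \<ominus> \<pi> [^] (k - m)) = \<pi> [^] m \<ominus> \<pi> [^] k"
    using * c by (simp add: a_minus_def r_distr r_minus)
  also have "\<dots> = \<zero>" using mk(2) c by (simp add: r_right_minus_eq)
  finally have "\<pi> [^] m = \<zero>"
    using u c by (metis Units_closed Units_l_cancel m_comm nat_pow_closed r_null zero_closed)
  then show ?thesis by blast
qed

text \<open>
  As long as the cofactor of a power of \<open>\<pi>\<close> is not a unit, another \<open>\<pi>\<close> splits off from it, and
  nilpotency stops the process. Zero is covered too: it is \<open>1\<close> times a vanishing power of \<open>\<pi>\<close>.
\<close>

lemma unit_times_uniformizer_power:
  assumes "uniformizer R \<pi>" and "x \<in> carrier R"
  shows "\<exists>u\<in>Units R. \<exists>n::nat. x = u \<otimes> \<pi> [^] n"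
proof -
  have c: "\<pi> \<in> carrier R" using assms uniformizer_def by metis
  have "(\<exists>u\<in>Units R. \<exists>n::nat. x = u \<otimes> \<pi> [^] n) \<or> (\<exists>r\<in>carrier R. x = r \<otimes> \<pi> [^] n)" for n :: nat
  proof (induction n)
    case 0
    then show ?case using assms(2) by auto
  next
    case (Suc n)
    show ?case
    proof (rule disjCI)
      assume n: "\<not> (\<exists>r\<in>carrier R. x = r \<otimes> \<pi> [^] Suc n)"
      show "\<exists>u\<in>Units R. \<exists>n::nat. x = u \<otimes> \<pi> [^] n"
      proof (rule ccontr)
        assume h: "\<not> (\<exists>u\<in>Units R. \<exists>n::nat. x = u \<otimes> \<pi> [^] n)"
        then obtain r where r: "r \<in> carrier R" "x = r \<otimes> \<pi> [^] n" using Suc by auto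
        then have "r \<notin> Units R" using h by auto
        then obtain s where s: "s \<in> carrier R" "r = s \<otimes> \<pi>"
          using r Units_iff_notin_max max_ideal_mem_iff[OF assms(1)] by auto
        have "x = s \<otimes> \<pi> [^] Suc n"
          using r s c by (simp add: m_ac)
        then show False using n s(1) by blast
      qed
    qed
  qed
  moreover obtain N :: nat where N: "\<pi> [^] N = \<zero>" using max_ideal_nilpotent[OF assms(1)] by auto
  ultimately have "(\<exists>u\<in>Units R. \<exists>n::nat. x = u \<otimes> \<pi> [^] n) \<or> x = \<zero>"
    by (metis r_null)
  moreover have "\<zero> = \<one> \<otimes> \<pi> [^] N" using N by simp
  ultimately show ?thesis using Units_one_closed by metis
qed

lemma uniformizer_pow_eq_zero_iff:
  assumes "uniformizer R \<pi>"
  shows "\<pi> [^] (n::nat) = \<zero> \<longleftrightarrow> nilpotency_index R \<le> n"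
proof -
  have c: "\<pi> \<in> carrier R" using assms uniformizer_def by metis
  have *: "ideal_power R (max_ideal R) n = {\<zero>} \<longleftrightarrow> \<pi> [^] n = \<zero>" for n :: nat
  proof -
    have "PIdl (\<pi> [^] n) = {\<zero>} \<longleftrightarrow> \<pi> [^] n = \<zero>"
    proof
      show "\<pi> [^] n = \<zero>" if "PIdl (\<pi> [^] n) = {\<zero>}"
        using that cgenideal_self[of "\<pi> [^] n"] c by auto
      show "PIdl (\<pi> [^] n) = {\<zero>}" if "\<pi> [^] n = \<zero>"
      proof (intro equalityI subsetI)
        show "x \<in> {\<zero>}" if "x \<in> PIdl (\<pi> [^] n)" for x
          using that \<open>\<pi> [^] n = \<zero>\<close> by (auto simp: PIdl_mem_iff)
        show "x \<in> PIdl (\<pi> [^] n)" if "x \<in> {\<zero>}" for x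
          using that \<open>\<pi> [^] n = \<zero>\<close> cgenideal_self[OF zero_closed] by simp
      qed
    qed
    then show ?thesis using ideal_power_uniformizer[OF assms] by metis
  qed
  obtain N :: nat where N: "\<pi> [^] N = \<zero>" using max_ideal_nilpotent[OF assms(1)] by auto
  have up: "\<pi> [^] m = \<zero>" if "\<pi> [^] n = \<zero>" "n \<le> m" for n m :: nat
    using that c nat_pow_mult[OF c, of n "m - n"] by simp
  have nz: "n \<noteq> 0" if "\<pi> [^] n = \<zero>" for n :: nat
    using that one_neq_zero nat_pow_0 by metis
  let ?a = "nilpotency_index R"
  have a: "?a = (LEAST n::nat. \<pi> [^] n = \<zero>)"
    unfolding nilpotency_index_def * using nz by (intro arg_cong[where f = Least]) auto
  show ?thesis
    unfolding a using up LeastI[of "\<lambda>n::nat. \<pi> [^] n = \<zero>", OF N]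
      Least_le[of "\<lambda>n::nat. \<pi> [^] n = \<zero>" n] by blast
qed

lemma char_elem_closed: "char_elem R \<in> carrier R"
  unfolding char_elem_def by simp

text \<open>
  If \<open>u \<pi>\<^sup>n\<close> were divisible by a higher power of \<open>\<pi>\<close>, then \<open>\<pi>\<^sup>n\<close> would be annihilated by some
  \<open>1 - y \<pi>\<close>, which is a unit.
\<close>

lemma ord_max_unit_times_power:
  assumes "uniformizer R \<pi>" "u \<in> Units R" "x = u \<otimes> \<pi> [^] n" "x \<noteq> \<zero>"
  shows "ord_max R x = n"
proof -
  have c: "\<pi> \<in> carrier R" "u \<in> carrier R" "x \<in> carrier R"
    using assms by (auto simp: uniformizer_def)
  have mem: "x \<in> ideal_power R (max_ideal R) k \<longleftrightarrow> k \<le> n" for k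
  proof
    assume "x \<in> ideal_power R (max_ideal R) k"
    then obtain r where r: "r \<in> carrier R" "x = r \<otimes> \<pi> [^] k"
      using ideal_power_uniformizer[OF assms(1)] PIdl_mem_iff by auto
    show "k \<le> n"
    proof (rule ccontr)
      assume "\<not> k \<le> n"
      then have k: "k = n + (k - n)" "k - n = Suc (k - n - 1)" by auto
      define y where "y = inv u \<otimes> r \<otimes> \<pi> [^] (k - n - 1)"
      have yc: "y \<in> carrier R" "y \<otimes> \<pi> \<in> carrier R" unfolding y_def using c r assms(2) by auto
      have "\<pi> [^] k = \<pi> [^] n \<otimes> (\<pi> [^] (k - n - 1) \<otimes> \<pi>)"
        using nat_pow_mult[OF c(1), of n "k - n"] k c by (metis nat_pow_Suc)
      moreover have "\<pi> [^] n = inv u \<otimes> x"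
        using assms(2,3) c by (simp add: m_assoc[symmetric])
      ultimately have "\<pi> [^] n = inv u \<otimes> (r \<otimes> (\<pi> [^] n \<otimes> (\<pi> [^] (k - n - 1) \<otimes> \<pi>)))"
        using r by simp
      also have "\<dots> = (y \<otimes> \<pi>) \<otimes> \<pi> [^] n"
        unfolding y_def using c r assms(2) by (simp add: m_ac)
      finally have "(\<one> \<ominus> y \<otimes> \<pi>) \<otimes> \<pi> [^] n = \<zero>"
        using c yc by (simp add: a_minus_def l_distr l_minus r_neg)
      moreover have "y \<otimes> \<pi> \<in> max_ideal R" using max_ideal_mem_iff[OF assms(1)] yc by auto
      then have "\<ominus> (y \<otimes> \<pi>) \<in> max_ideal R"
        by (metis ideal.axioms(1) max_ideal_ideal additive_subgroup.a_inv_closed)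
      then have "\<one> \<ominus> y \<otimes> \<pi> \<in> Units R"
        unfolding a_minus_def using Units_plus_max_ideal by blast
      ultimately have "\<pi> [^] n = \<zero>"
        using c by (metis Units_closed Units_l_cancel nat_pow_closed r_null zero_closed)
      then show False using assms(3,4) c by simp
    qed
  next
    assume "k \<le> n"
    then have "x = (u \<otimes> \<pi> [^] (n - k)) \<otimes> \<pi> [^] k"
      using assms(3) c nat_pow_mult[OF c(1), of "n - k" k] by (simp add: m_assoc)
    then show "x \<in> ideal_power R (max_ideal R) k"
      using ideal_power_uniformizer[OF assms(1)] PIdl_mem_iff c by auto
  qed
  show ?thesis
  proof -
    have "(THE k. x \<in> ideal_power R (max_ideal R) k - ideal_power R (max_ideal R) (Suc k)) = n"
      unfolding Diff_iff mem by (rule the_equality) auto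
    then show ?thesis unfolding ord_max_def using assms(4) by simp
  qed
qed

text \<open>
  The hypothesis excludes \<open>p = 0\<close> in \<open>R\<close>, the case in which the ramification index is the
  conventional value and not an exponent read off from \<open>p\<close>.
\<close>

lemma char_elem_unit_times_power:
  assumes "uniformizer R \<pi>" and "ram_index R < nilpotency_index R"
  shows "\<exists>w\<in>Units R. char_elem R = w \<otimes> \<pi> [^] ram_index R"
proof -
  have nz: "char_elem R \<noteq> \<zero>" using assms(2) unfolding ram_index_def ord_max_def by auto
  show ?thesis
    using unit_times_uniformizer_power[OF assms(1) char_elem_closed]
      ord_max_unit_times_power[OF assms(1) _ _ nz] unfolding ram_index_def by metis
qed

end

section \<open>The residue field\<close>

text \<open>
  Coordinates with respect to a basis identify the space with the lists of length \<open>n\<close> over \<open>K\<close>.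
\<close>

lemma (in ring) card_dimension:
  assumes K: "subfield K R" and "finite K" and dim: "dimension n K E"
  shows "card E = card K ^ n"
proof -
  obtain Vs where Vs: "set Vs \<subseteq> carrier R" "independent K Vs" "length Vs = n" "Span K Vs = E"
    using exists_base[OF K dim] by blast
  let ?L = "{Ks. set Ks \<subseteq> K \<and> length Ks = n}"
  have img: "(\<lambda>Ks. combine Ks Vs) ` ?L = E"
    using Span_eq_combine_set_length_version[OF K Vs(1)] Vs(3,4) by auto
  moreover have "inj_on (\<lambda>Ks. combine Ks Vs) ?L"
    using unique_decomposition[OF K Vs(2)] img Vs(3,4) unfolding inj_on_def
    by (smt (verit, best) image_eqI mem_Collect_eq)
  ultimately have "card E = card ?L"
    using card_image by blast
  then show ?thesis using card_lists_length_eq[OF assms(2)] by simp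
qed

context field
begin

lemma finite_ring_characteristic:
  assumes "finite (carrier R)"
  shows "0 < ring_characteristic R" and "[ring_characteristic R] \<cdot> \<one> = \<zero>"
    and "0 < m \<Longrightarrow> [m] \<cdot> \<one> = \<zero> \<Longrightarrow> ring_characteristic R \<le> m"
proof -
  have ex: "\<exists>n::nat. 0 < n \<and> [n] \<cdot> \<one> = \<zero>"
    using add.pow_order_eq_1[of \<one>] add.order_gt_0_iff_finite assms by auto
  have d: "ring_characteristic R = (LEAST n::nat. 0 < n \<and> [n] \<cdot> \<one> = \<zero>)"
    unfolding ring_characteristic_def if_P[OF ex] ..
  show "0 < ring_characteristic R" "[ring_characteristic R] \<cdot> \<one> = \<zero>"
    unfolding d using LeastI_ex[OF ex] by auto
  show "ring_characteristic R \<le> m" if "0 < m" "[m] \<cdot> \<one> = \<zero>"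
    unfolding d using that by (intro Least_le) auto
qed

lemma nat_multiple_one_eq_zero_iff:
  assumes "finite (carrier R)"
  shows "[(m::nat)] \<cdot> \<one> = \<zero> \<longleftrightarrow> ring_characteristic R dvd m"
proof -
  let ?p = "ring_characteristic R"
  note p = finite_ring_characteristic[OF assms]
  have z: "[(?p * k)] \<cdot> \<one> = \<zero>" for k
    using add.nat_pow_pow[of \<one> k ?p] p(2) by (simp add: mult.commute)
  have "[m] \<cdot> \<one> = [(?p * (m div ?p) + m mod ?p)] \<cdot> \<one>" by simp
  also have "\<dots> = [(?p * (m div ?p))] \<cdot> \<one> \<oplus> [(m mod ?p)] \<cdot> \<one>"
    by (rule add.nat_pow_mult[symmetric]) simp
  also have "\<dots> = [(m mod ?p)] \<cdot> \<one>" using z by simp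
  finally have *: "[m] \<cdot> \<one> = [(m mod ?p)] \<cdot> \<one>" .
  show ?thesis
  proof
    assume "[m] \<cdot> \<one> = \<zero>"
    then have "m mod ?p = 0" using p(3)[of "m mod ?p"] * mod_less_divisor[OF p(1), of m] by fastforce
    then show "?p dvd m" by auto
  next
    assume "?p dvd m" then show "[m] \<cdot> \<one> = \<zero>" using z by auto
  qed
qed

lemma nat_multiple_one_mult: "[(m::nat)] \<cdot> \<one> \<otimes> [(n::nat)] \<cdot> \<one> = [(m * n)] \<cdot> \<one>"
  using add_pow_ldistr[of \<one> "[n] \<cdot> \<one>" m] add.nat_pow_pow[of \<one> m n] by (simp add: mult.commute)

lemma ring_characteristic_prime:
  assumes "finite (carrier R)"
  shows "Factorial_Ring.prime (ring_characteristic R)"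
  unfolding prime_nat_iff
proof (intro conjI allI impI)
  let ?p = "ring_characteristic R"
  note p = finite_ring_characteristic[OF assms]
  show "1 < ?p" using p(1,2) one_not_zero
    by (metis One_nat_def Suc_lessI add.nat_pow_eone one_closed)
  show "m = 1 \<or> m = ?p" if "m dvd ?p" for m
  proof -
    obtain k where k: "?p = m * k" using \<open>m dvd ?p\<close> by auto
    then have "[m] \<cdot> \<one> = \<zero> \<or> [k] \<cdot> \<one> = \<zero>"
      using p(2) nat_multiple_one_mult[of m k] integral by auto
    then have "?p dvd m \<or> ?p dvd k"
      using nat_multiple_one_eq_zero_iff[OF assms] by simp
    then show ?thesis using k p(1) by (metis dvd_antisym dvd_triv_left dvd_triv_right mult_cancel2 mult_1 nat_0_less_mult_iff neq0_conv)
  qed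
qed

text \<open>
  The multiples of \<open>1\<close> already form the prime field: they are closed under products, hence under
  powers, and in a finite unit group inverses are powers.
\<close>

lemma card_prime_field:
  assumes fin: "finite (carrier R)"
  shows "card (generate_field R {}) = ring_characteristic R"
proof -
  let ?p = "ring_characteristic R"
  note p = finite_ring_characteristic[OF fin]
  define F where "F = range (\<lambda>n::nat. [n] \<cdot> \<one>)"
  have Fc: "F \<subseteq> carrier R" unfolding F_def by auto
  have pow: "h [^] (n::nat) \<in> F" if "h \<in> F" for h n
  proof (induction n)
    case 0
    have "\<one> = [(1::nat)] \<cdot> \<one>" by simp
    then have "\<one> \<in> F" unfolding F_def by (rule range_eqI)
    then show ?case by simp
  next
    case (Suc n)
    then show ?case using that nat_multiple_one_mult unfolding F_def by auto
  qed
  have inv: "inv h \<in> F" if "h \<in> F" "h \<noteq> \<zero>" for h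
  proof -
    have u: "h \<in> Units R" "h \<in> carrier R" using that Fc field_Units by auto
    let ?k = "card (Units R)"
    have "finite (Units R)" using fin by (rule finite_subset[rotated]) auto
    then have k: "h [^] ?k = \<one>" "?k > 0"
      using units_power_order_eq_one u by (auto simp: card_gt_0_iff)
    then have "h [^] (?k - 1) \<otimes> h = \<one>" by (metis Suc_pred' nat_pow_Suc)
    then have "inv h = h [^] (?k - 1)" using u by (metis inv_char m_comm nat_pow_closed)
    then show ?thesis using pow that by simp
  qed
  have gen: "x \<in> F" if "x \<in> generate_field R {}" for x
    using that
  proof (induction rule: generate_field.induct)
    case one
    have "\<one> = [(1::nat)] \<cdot> \<one>" by simp
    then have "\<one> \<in> F" unfolding F_def by (rule range_eqI)
    then show ?case by simp
  next
    case (a_inv h)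
    then obtain n :: nat where n: "h = [n] \<cdot> \<one>" unfolding F_def by auto
    have "[(?p * n)] \<cdot> \<one> = \<zero>" using nat_multiple_one_eq_zero_iff[OF fin] by simp
    moreover have "?p * n = n + (?p * n - n)" using p(1) by simp
    ultimately have "h \<oplus> [(?p * n - n)] \<cdot> \<one> = \<zero>"
      using n add.nat_pow_mult[of \<one> n "?p * n - n"] by simp
    then have "\<ominus> h = [(?p * n - n)] \<cdot> \<one>"
      using n minus_equality[of "[(?p * n - n)] \<cdot> \<one>" h] a_comm by simp
    then show ?case unfolding F_def by auto
  next
    case (eng_add h1 h2)
    then show ?case unfolding F_def by (auto simp: add.nat_pow_mult)
  next
    case (eng_mult h1 h2)
    then show ?case unfolding F_def by (auto simp: nat_multiple_one_mult)
  qed (auto intro: inv)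
  have "[n] \<cdot> \<one> \<in> generate_field R {}" for n :: nat
    by (induction n) (auto intro: generate_field.eng_add generate_field.one simp: zero_in_generate)
  then have eq: "generate_field R {} = F" using gen unfolding F_def by blast
  have "F = (\<lambda>n::nat. [n] \<cdot> \<one>) ` {..<?p}"
  proof -
    have "[m] \<cdot> \<one> = [(m mod ?p)] \<cdot> \<one>" for m :: nat
    proof -
      have "[(?p * (m div ?p))] \<cdot> \<one> = \<zero>" using nat_multiple_one_eq_zero_iff[OF fin] by simp
      then show ?thesis
        using add.nat_pow_mult[of \<one> "?p * (m div ?p)" "m mod ?p"] by simp
    qed
    then show ?thesis unfolding F_def using mod_less_divisor[OF p(1)] by blast
  qed
  moreover have "inj_on (\<lambda>n::nat. [n] \<cdot> \<one>) {..<?p}"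
  proof (rule linorder_inj_onI)
    fix m n assume mn: "m < n" "m \<in> {..<?p}" "n \<in> {..<?p}"
    show "[m] \<cdot> \<one> \<noteq> [n] \<cdot> \<one>"
    proof
      assume "[m] \<cdot> \<one> = [n] \<cdot> \<one>"
      moreover have "[n] \<cdot> \<one> = [m] \<cdot> \<one> \<oplus> [(n - m)] \<cdot> \<one>"
        using add.nat_pow_mult[of \<one> m "n - m"] mn by simp
      ultimately have "[(n - m)] \<cdot> \<one> = \<zero>"
        using add.r_cancel_one'[of "[m] \<cdot> \<one>" "[(n - m)] \<cdot> \<one>"] by simp
      then show False using p(3)[of "n - m"] mn by auto
    qed
  qed auto
  ultimately show ?thesis using eq card_image by fastforce
qed

lemma card_eq_characteristic_power:
  assumes fin: "finite (carrier R)"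
  shows "card (carrier R) = ring_characteristic R ^ dim (generate_field R {}) (carrier R)"
proof -
  let ?K = "generate_field R {}"
  have K: "subfield ?K R" by (rule generate_field_is_subfield) simp
  obtain Us where Us: "set Us = carrier R" using fin finite_list by blast
  have "Span ?K Us = carrier R"
    using Span_base_incl[OF K, of Us] Span_in_carrier[of ?K Us] generate_field_incl[of "{}"] Us
    by (simp only: subset_refl empty_subsetI subset_antisym)
  then have "finite_dimension ?K (carrier R)"
    using Span_finite_dimension[OF K, of Us] Us by auto
  then have "dimension (dim ?K (carrier R)) ?K (carrier R)"
    using finite_dimensionE[OF K] unfolding over_def by simp
  moreover have "finite ?K" using fin generate_field_incl[of "{}"] finite_subset by blast
  ultimately show ?thesis using card_dimension[OF K] card_prime_field[OF fin] by metis
qed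

lemma finite_field_pow_card:
  assumes fin: "finite (carrier R)" and x: "x \<in> carrier R"
  shows "x [^] card (carrier R) = x"
proof -
  have c: "card (carrier R) = Suc (card (Units R))"
    using card.remove[OF fin zero_closed] by (simp add: field_Units)
  show ?thesis
  proof (cases "x = \<zero>")
    case True
    then show ?thesis by (simp add: c)
  next
    case False
    then have "x \<in> Units R" using x field_Units by simp
    moreover have "finite (Units R)" using fin by (rule finite_subset[rotated]) auto
    ultimately show ?thesis using units_power_order_eq_one x by (simp add: c)
  qed
qed

end

context finite_local_pir
begin

lemma residue_field_field: "field (residue_field R)"
  unfolding residue_field_def
  using max_ideal_maximal maximalideal.quotient_is_field cring_axioms by blast

lemma residue_field_finite: "finite (carrier (residue_field R))"
  unfolding residue_field_def FactRing_simps using finite_carrier by auto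

lemma residue_char_prime: "Factorial_Ring.prime (residue_char R)"
  unfolding residue_char_def
  by (rule field.ring_characteristic_prime[OF residue_field_field residue_field_finite])

lemma card_residue_field: "card (carrier (residue_field R)) = residue_char R ^ residue_degree R"
  unfolding residue_char_def residue_degree_def
  by (rule field.card_eq_characteristic_power[OF residue_field_field residue_field_finite])

lemma residue_eq_iff:
  assumes "x \<in> carrier R" "y \<in> carrier R"
  shows "max_ideal R +> x = max_ideal R +> y \<longleftrightarrow> x \<ominus> y \<in> max_ideal R"
  using quotient_eq_iff_same_a_r_cos[OF max_ideal_ideal assms] by blast

lemma residue_ring_hom_ring: "ring_hom_ring R (residue_field R) ((+>) (max_ideal R))"
  unfolding residue_field_def by (rule ideal.rcos_ring_hom_ring[OF max_ideal_ideal])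

lemma char_elem_in_max: "char_elem R \<in> max_ideal R"
proof -
  interpret k: field "residue_field R" by (rule residue_field_field)
  interpret h: ring_hom_ring R "residue_field R" "(+>) (max_ideal R)" by (rule residue_ring_hom_ring)
  have hn: "max_ideal R +> ([n] \<cdot> \<one>) = [n] \<cdot>\<^bsub>residue_field R\<^esub> \<one>\<^bsub>residue_field R\<^esub>" for n :: nat
    by (induction n) auto
  have "max_ideal R +> char_elem R = max_ideal R +> \<zero>"
    unfolding char_elem_def hn
    using k.finite_ring_characteristic(2)[OF residue_field_finite]
    by (simp add: residue_char_def)
  then have "char_elem R \<ominus> \<zero> \<in> max_ideal R"
    using residue_eq_iff char_elem_closed by blast
  then show ?thesis using char_elem_closed by (simp add: a_minus_def)
qed

lemma pow_card_residue_field: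
  assumes "x \<in> carrier R"
  shows "x [^] (residue_char R ^ residue_degree R) \<ominus> x \<in> max_ideal R"
proof -
  interpret k: field "residue_field R" by (rule residue_field_field)
  interpret h: ring_hom_ring R "residue_field R" "(+>) (max_ideal R)" by (rule residue_ring_hom_ring)
  have "max_ideal R +> (x [^] (residue_char R ^ residue_degree R)) = max_ideal R +> x"
    using k.finite_field_pow_card[OF residue_field_finite, of "max_ideal R +> x"] assms
    by (simp add: card_residue_field h.hom_nat_pow)
  then show ?thesis using residue_eq_iff assms by blast
qed

end

section \<open>Frobenius congruences and Teichmueller representatives\<close>

context cring
begin

lemma binomial_theorem:
  assumes "x \<in> carrier R" "y \<in> carrier R"
  shows "(x \<oplus> y) [^] n = (\<Oplus>i\<in>{..n}. [(n choose i)] \<cdot> (x [^] i \<otimes> y [^] (n - i)))"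
proof (induction n)
  case 0
  show ?case using assms by simp
next
  case (Suc n)
  let ?g = "\<lambda>i. x [^] i \<otimes> y [^] (Suc n - i)"
  let ?f = "\<lambda>i. [(n choose i)] \<cdot> (x [^] i \<otimes> y [^] (n - i))"
  have y_shift: "y \<otimes> ?f i = [(n choose i)] \<cdot> ?g i" if "i \<le> n" for i
  proof -
    have "y \<otimes> (x [^] i \<otimes> y [^] (n - i)) = ?g i"
      using assms that by (simp add: Suc_diff_le m_ac)
    then show ?thesis using assms by (simp add: add_pow_rdistr)
  qed
  have x_shift: "x \<otimes> ?f i = [(n choose i)] \<cdot> ?g (Suc i)" for i
  proof -
    have "x \<otimes> (x [^] i \<otimes> y [^] (n - i)) = ?g (Suc i)"
      using assms by (simp add: m_ac)
    then show ?thesis using assms by (simp add: add_pow_rdistr)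
  qed
  have top: "(\<Oplus>i\<in>{..n}. [(n choose i)] \<cdot> ?g i)
      = (\<Oplus>i\<in>{..n}. [(n choose Suc i)] \<cdot> ?g (Suc i)) \<oplus> ?g 0"
  proof -
    have "(\<Oplus>i\<in>{..n}. [(n choose i)] \<cdot> ?g i) = (\<Oplus>i\<in>{..Suc n}. [(n choose i)] \<cdot> ?g i)"
      using assms by (subst finsum_Suc) (auto simp: Pi_def binomial_eq_0)
    also have "\<dots> = (\<Oplus>i\<in>{..n}. [(n choose Suc i)] \<cdot> ?g (Suc i)) \<oplus> ?g 0"
      using assms by (subst finsum_Suc2) (auto simp: Pi_def)
    finally show ?thesis .
  qed
  have "(x \<oplus> y) [^] Suc n = x \<otimes> (\<Oplus>i\<in>{..n}. ?f i) \<oplus> y \<otimes> (\<Oplus>i\<in>{..n}. ?f i)"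
    using assms by (simp add: Suc l_distr m_comm Pi_def)
  also have "\<dots> = (\<Oplus>i\<in>{..n}. x \<otimes> ?f i) \<oplus> (\<Oplus>i\<in>{..n}. y \<otimes> ?f i)"
    using assms by (simp add: finsum_rdistr Pi_def)
  also have "\<dots> = (\<Oplus>i\<in>{..n}. [(n choose i)] \<cdot> ?g (Suc i)) \<oplus> (\<Oplus>i\<in>{..n}. [(n choose i)] \<cdot> ?g i)"
    unfolding x_shift
    by (intro arg_cong2[where f = "add R"] refl add.finprod_cong')
      (use y_shift assms in \<open>auto simp: Pi_def\<close>)
  also have "\<dots> = ((\<Oplus>i\<in>{..n}. [(n choose i)] \<cdot> ?g (Suc i))
      \<oplus> (\<Oplus>i\<in>{..n}. [(n choose Suc i)] \<cdot> ?g (Suc i))) \<oplus> ?g 0"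
    unfolding top using assms by (simp add: a_assoc Pi_def)
  also have "\<dots> = (\<Oplus>i\<in>{..n}. [(Suc n choose Suc i)] \<cdot> ?g (Suc i)) \<oplus> ?g 0"
    using assms by (simp add: finsum_addf[symmetric] add.nat_pow_mult Pi_def)
  also have "\<dots> = (\<Oplus>i\<in>{..Suc n}. [(Suc n choose i)] \<cdot> ?g i)"
    using assms by (subst finsum_Suc2) (auto simp: Pi_def)
  finally show ?case .
qed

text \<open>
  The binomial coefficients strictly between the ends are divisible by \<open>p\<close>. The factor
  \<open>x \<otimes> y\<close> in the error term matters: when \<open>y\<close> is divisible by a power of a uniformizer, so is
  the whole error.
\<close>

lemma frobenius_add:
  assumes p: "Factorial_Ring.prime (p::nat)" and xy: "x \<in> carrier R" "y \<in> carrier R"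
  shows "\<exists>w\<in>carrier R. (x \<oplus> y) [^] p = x [^] p \<oplus> y [^] p \<oplus> ([p] \<cdot> \<one>) \<otimes> (x \<otimes> y \<otimes> w)"
proof -
  obtain k where k: "p = Suc (Suc k)"
    using le_Suc_ex[OF prime_ge_2_nat[OF p]] by auto
  let ?f = "\<lambda>i. [(p choose i)] \<cdot> (x [^] i \<otimes> y [^] (p - i))"
  define h where "h i = [((p choose Suc i) div p)] \<cdot> (x [^] i \<otimes> y [^] (k - i))" for i
  have h: "?f (Suc i) = (([p] \<cdot> \<one>) \<otimes> (x \<otimes> y)) \<otimes> h i" if "i \<le> k" for i
  proof -
    let ?c = "(p choose Suc i) div p"
    have "p dvd (p choose Suc i)"
      by (rule dvd_choose_prime) (use that p k in auto)
    then have c: "p choose Suc i = ?c * p" by simp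
    have "x [^] Suc i \<otimes> y [^] (p - Suc i) = (x \<otimes> y) \<otimes> (x [^] i \<otimes> y [^] (k - i))"
      using xy that by (simp add: k Suc_diff_le m_ac)
    then have "?f (Suc i) = [(?c * p)] \<cdot> ((x \<otimes> y) \<otimes> (x [^] i \<otimes> y [^] (k - i)))"
      using c by simp
    also have "\<dots> = [p] \<cdot> ((x \<otimes> y) \<otimes> h i)"
      unfolding h_def using xy
      by (simp add: add_pow_rdistr add.nat_pow_pow mult.commute)
    also have "\<dots> = ([p] \<cdot> \<one>) \<otimes> ((x \<otimes> y) \<otimes> h i)"
      unfolding h_def using xy by (simp add: add_pow_ldistr)
    finally show ?thesis unfolding h_def using xy by (simp add: m_assoc)
  qed
  have hc: "h i \<in> carrier R" for i unfolding h_def using xy by simp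
  have "(x \<oplus> y) [^] p = (\<Oplus>i\<in>{..Suc (Suc k)}. ?f i)"
    using binomial_theorem[OF xy, of p] k by simp
  also have "\<dots> = ?f (Suc (Suc k)) \<oplus> (\<Oplus>i\<in>{..Suc k}. ?f i)"
    using xy by (intro finsum_Suc) auto
  also have "(\<Oplus>i\<in>{..Suc k}. ?f i) = (\<Oplus>i\<in>{..k}. ?f (Suc i)) \<oplus> ?f 0"
    using xy by (intro finsum_Suc2) auto
  also have "(\<Oplus>i\<in>{..k}. ?f (Suc i)) = (\<Oplus>i\<in>{..k}. (([p] \<cdot> \<one>) \<otimes> (x \<otimes> y)) \<otimes> h i)"
    by (intro add.finprod_cong') (use h hc xy in \<open>auto simp: Pi_def\<close>)
  also have "\<dots> = (([p] \<cdot> \<one>) \<otimes> (x \<otimes> y)) \<otimes> (\<Oplus>i\<in>{..k}. h i)"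
    using hc xy by (intro finsum_rdistr[symmetric]) auto
  also have "?f (Suc (Suc k)) = x [^] p" using xy k by simp
  also have "?f 0 = y [^] p" using xy by simp
  finally have "(x \<oplus> y) [^] p = x [^] p \<oplus> y [^] p
      \<oplus> ([p] \<cdot> \<one>) \<otimes> (x \<otimes> y \<otimes> (\<Oplus>i\<in>{..k}. h i))"
    using xy hc by (simp add: a_ac m_assoc Pi_def)
  moreover have "(\<Oplus>i\<in>{..k}. h i) \<in> carrier R" using hc by (simp add: Pi_def)
  ultimately show ?thesis by blast
qed

lemma frobenius_power_add:
  assumes p: "Factorial_Ring.prime (p::nat)" and xy: "x \<in> carrier R" "y \<in> carrier R"
  shows "\<exists>w\<in>carrier R. (x \<oplus> y) [^] (p ^ f) = x [^] (p ^ f) \<oplus> y [^] (p ^ f) \<oplus> ([p] \<cdot> \<one>) \<otimes> w"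
proof (induction f)
  case 0
  have "x \<oplus> y = x \<oplus> y \<oplus> ([p] \<cdot> \<one>) \<otimes> \<zero>" using xy by simp
  then show ?case using xy zero_closed by (metis add.m_closed nat_pow_eone power_0)
next
  case (Suc f)
  let ?c = "[p] \<cdot> \<one>" and ?A = "x [^] (p ^ f)" and ?B = "y [^] (p ^ f)"
  have AB: "?A \<in> carrier R" "?B \<in> carrier R" "?c \<in> carrier R" using xy by auto
  obtain w where w: "w \<in> carrier R" "(x \<oplus> y) [^] (p ^ f) = ?A \<oplus> ?B \<oplus> ?c \<otimes> w"
    using Suc by blast
  obtain v where v: "v \<in> carrier R"
    "(?A \<oplus> ?B) [^] p = ?A [^] p \<oplus> ?B [^] p \<oplus> ?c \<otimes> (?A \<otimes> ?B \<otimes> v)"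
    using frobenius_add[OF p AB(1,2)] by blast
  obtain u where u: "u \<in> carrier R"
    "(?A \<oplus> ?B \<oplus> ?c \<otimes> w) [^] p = (?A \<oplus> ?B) [^] p \<oplus> (?c \<otimes> w) [^] p
       \<oplus> ?c \<otimes> ((?A \<oplus> ?B) \<otimes> (?c \<otimes> w) \<otimes> u)"
    using frobenius_add[OF p, of "?A \<oplus> ?B" "?c \<otimes> w"] AB w by auto
  define s where "s = (?c \<otimes> w) [^] (p - 1)"
  have s: "s \<in> carrier R" unfolding s_def using AB w by auto
  have "(?c \<otimes> w) [^] p = s \<otimes> (?c \<otimes> w)"
    unfolding s_def using nat_pow_Suc[of "?c \<otimes> w" "p - 1"] prime_gt_0_nat[OF p]
    by (simp only: Suc_diff_1)
  also have "\<dots> = ?c \<otimes> (w \<otimes> s)"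
    using m_lcomm[OF s AB(3) w(1)] m_comm[OF s w(1)] by (simp only:)
  finally have pp: "(?c \<otimes> w) [^] p = ?c \<otimes> (w \<otimes> s)" .
  define A' B' where "A' = ?A [^] p" and "B' = ?B [^] p"
  have AB': "A' \<in> carrier R" "B' \<in> carrier R" unfolding A'_def B'_def using xy by auto
  have AB'': "A' = x [^] (p ^ Suc f)" "B' = y [^] (p ^ Suc f)"
    unfolding A'_def B'_def using xy by (simp_all add: nat_pow_pow mult.commute)
  have "(x \<oplus> y) [^] (p ^ Suc f) = ((x \<oplus> y) [^] (p ^ f)) [^] p"
    using xy by (simp add: nat_pow_pow mult.commute)
  also have "\<dots> = A' \<oplus> B' \<oplus> ?c \<otimes> (?A \<otimes> ?B \<otimes> v) \<oplus> ?c \<otimes> (w \<otimes> s)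
      \<oplus> ?c \<otimes> ((?A \<oplus> ?B) \<otimes> (?c \<otimes> w) \<otimes> u)"
    unfolding w(2) u(2) v(2) pp A'_def B'_def ..
  also have "\<dots> = A' \<oplus> B' \<oplus> ?c \<otimes> (?A \<otimes> ?B \<otimes> v \<oplus> w \<otimes> s \<oplus> (?A \<oplus> ?B) \<otimes> (?c \<otimes> w) \<otimes> u)"
    using AB AB' u(1) v(1) w(1) s by (simp add: r_distr a_assoc)
  finally show ?case
    unfolding AB'' by (rule bexI) (intro add.m_closed m_closed AB u(1) v(1) w(1) s)
qed

end

context finite_local_pir
begin

text \<open>The cardinality of the residue field, by lemma \<open>card_residue_field\<close>.\<close>

abbreviation (input) "q\<^sub>R \<equiv> residue_char R ^ residue_degree R"

lemma residue_degree_pos: "0 < residue_degree R"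
proof (rule ccontr)
  assume "\<not> 0 < residue_degree R"
  then have "card (carrier (residue_field R)) = 1" using card_residue_field by simp
  moreover interpret k: field "residue_field R" by (rule residue_field_field)
  have "{\<zero>\<^bsub>residue_field R\<^esub>, \<one>\<^bsub>residue_field R\<^esub>} \<subseteq> carrier (residue_field R)" by auto
  ultimately show False
    using k.one_not_zero card_mono[OF residue_field_finite, of "{\<zero>\<^bsub>residue_field R\<^esub>, \<one>\<^bsub>residue_field R\<^esub>}"]
    by auto
qed

lemma residue_card_gt_one: "1 < residue_char R ^ residue_degree R"
  using residue_degree_pos prime_gt_1_nat[OF residue_char_prime] by (metis one_less_power)

text \<open>
  Raising to the power \<open>p\<close> improves a congruence by one power of \<open>\<pi>\<close>: with \<open>x = y + z\<close>, the
  term \<open>z\<^sup>p\<close> is divisible by \<open>z\<^sup>2\<close>, and the mixed terms by \<open>p z\<close>, where \<open>p\<close> itself is divisible by \<open>\<pi>\<close>.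
\<close>

lemma pow_char_congruence:
  assumes u: "uniformizer R \<pi>" and xy: "x \<in> carrier R" "y \<in> carrier R" "r \<in> carrier R"
    and "0 < j" and eq: "x = y \<oplus> r \<otimes> \<pi> [^] (j::nat)"
  shows "\<exists>s\<in>carrier R. x [^] residue_char R = y [^] residue_char R \<oplus> s \<otimes> \<pi> [^] Suc j"
proof -
  let ?p = "residue_char R"
  have c: "\<pi> \<in> carrier R" using u uniformizer_def by metis
  obtain d where d: "d \<in> carrier R" "char_elem R = d \<otimes> \<pi>"
    using char_elem_in_max max_ideal_mem_iff[OF u] by blast
  let ?z = "r \<otimes> \<pi> [^] j"
  have z: "?z \<in> carrier R" using xy c by simp
  obtain w where w: "w \<in> carrier R"
    "(y \<oplus> ?z) [^] ?p = y [^] ?p \<oplus> ?z [^] ?p \<oplus> char_elem R \<otimes> (y \<otimes> ?z \<otimes> w)"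
    using frobenius_add[OF residue_char_prime xy(2) z] unfolding char_elem_def by blast
  obtain k i where k: "?p = Suc (Suc k)" "j = Suc i"
    using le_Suc_ex[OF prime_ge_2_nat[OF residue_char_prime]] gr0_implies_Suc[OF \<open>0 < j\<close>] by auto
  have "?z [^] ?p = (?z [^] k \<otimes> r \<otimes> r \<otimes> \<pi> [^] i) \<otimes> \<pi> [^] Suc j"
    using xy c unfolding k by (simp add: m_ac)
  moreover have "char_elem R \<otimes> (y \<otimes> ?z \<otimes> w) = (d \<otimes> y \<otimes> r \<otimes> w) \<otimes> \<pi> [^] Suc j"
    using d xy c w by (simp add: m_ac)
  ultimately have "x [^] ?p = y [^] ?p \<oplus> (?z [^] k \<otimes> r \<otimes> r \<otimes> \<pi> [^] i \<oplus> d \<otimes> y \<otimes> r \<otimes> w) \<otimes> \<pi> [^] Suc j"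
    unfolding eq w(2) using d xy c w z by (simp add: l_distr a_assoc)
  moreover have "?z [^] k \<otimes> r \<otimes> r \<otimes> \<pi> [^] i \<oplus> d \<otimes> y \<otimes> r \<otimes> w \<in> carrier R"
    using d xy c w z by simp
  ultimately show ?thesis by blast
qed

lemma pow_char_power_congruence:
  assumes u: "uniformizer R \<pi>" and xy: "x \<in> carrier R" "y \<in> carrier R"
    and eq: "x \<ominus> y \<in> max_ideal R"
  shows "\<exists>s\<in>carrier R. x [^] (residue_char R ^ n) = y [^] (residue_char R ^ n) \<oplus> s \<otimes> \<pi> [^] Suc n"
proof (induction n)
  case 0
  have c: "\<pi> \<in> carrier R" using u uniformizer_def by metis
  obtain r where r: "r \<in> carrier R" "x \<ominus> y = r \<otimes> \<pi>"
    using max_ideal_mem_iff[OF u] eq by blast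
  have "x = y \<oplus> (x \<ominus> y)" using xy by algebra
  then have "x = y \<oplus> r \<otimes> \<pi> [^] Suc 0" using r c by simp
  then show ?case using r(1) xy by auto
next
  case (Suc n)
  then obtain s where "s \<in> carrier R"
      "x [^] (residue_char R ^ n) = y [^] (residue_char R ^ n) \<oplus> s \<otimes> \<pi> [^] Suc n" by blast
  then obtain s' where s': "s' \<in> carrier R"
      "(x [^] (residue_char R ^ n)) [^] residue_char R
        = (y [^] (residue_char R ^ n)) [^] residue_char R \<oplus> s' \<otimes> \<pi> [^] Suc (Suc n)"
    using pow_char_congruence[OF u, of "x [^] (residue_char R ^ n)" "y [^] (residue_char R ^ n)" s "Suc n"] xy
    by blast
  have "(z [^] (residue_char R ^ n)) [^] residue_char R = z [^] (residue_char R ^ Suc n)"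
    if "z \<in> carrier R" for z
    using that by (simp add: nat_pow_pow mult.commute)
  then show ?case using s' xy by metis
qed

text \<open>
  Since \<open>x\<^sup>q\<close> and \<open>x\<close> agree in the residue field, their powers with exponent \<open>q\<^sup>a\<close> agree up to
  a multiple of \<open>\<pi>\<^sup>a\<close>, that is, exactly. By \<open>teichmueller_congruent\<close> this fixed point lies in
  the residue class of \<open>x\<close>, so it is the Teichmueller representative of that class.
\<close>

lemma teichmueller_fixed:
  assumes x: "x \<in> carrier R"
  shows "x [^] (q\<^sub>R ^ nilpotency_index R) \<in> rho R"
proof -
  let ?a = "nilpotency_index R" and ?f = "residue_degree R" and ?p = "residue_char R"
  obtain \<pi> where u: "uniformizer R \<pi>" using uniformizer_ex by blast
  then have c: "\<pi> \<in> carrier R" using uniformizer_def by metis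
  obtain s where s: "s \<in> carrier R"
    "(x [^] q\<^sub>R) [^] (?p ^ (?f * ?a)) = x [^] (?p ^ (?f * ?a)) \<oplus> s \<otimes> \<pi> [^] Suc (?f * ?a)"
    using pow_char_power_congruence[OF u _ x pow_card_residue_field[OF x]] x by blast
  have "?a \<le> Suc (?f * ?a)" using residue_degree_pos by (simp add: trans_le_add1 le_SucI)
  then have "\<pi> [^] Suc (?f * ?a) = \<zero>" using uniformizer_pow_eq_zero_iff[OF u] by blast
  then have "(x [^] q\<^sub>R) [^] (?p ^ (?f * ?a)) = x [^] (?p ^ (?f * ?a))"
    using s x by (simp del: nat_pow_Suc)
  moreover have "q\<^sub>R ^ ?a = ?p ^ (?f * ?a)" by (rule power_mult[symmetric])
  moreover have "(x [^] (?p ^ (?f * ?a))) [^] q\<^sub>R = (x [^] q\<^sub>R) [^] (?p ^ (?f * ?a))"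
    using x by (simp add: nat_pow_pow mult.commute)
  ultimately show ?thesis unfolding rho_def using x by simp
qed

lemma teichmueller_congruent:
  assumes x: "x \<in> carrier R"
  shows "x [^] (q\<^sub>R ^ n) \<ominus> x \<in> max_ideal R"
proof (induction n)
  case 0
  then show ?case using x ideal.axioms(1)[OF max_ideal_ideal] additive_subgroup.zero_closed
    by (metis nat_pow_eone power_0 r_right_minus_eq)
next
  case (Suc n)
  let ?y = "x [^] (q\<^sub>R ^ n)"
  have y: "?y \<in> carrier R" using x by simp
  have "x [^] (q\<^sub>R ^ Suc n) = ?y [^] q\<^sub>R" using x by (simp add: nat_pow_pow mult.commute)
  then have "x [^] (q\<^sub>R ^ Suc n) \<ominus> x = (?y [^] q\<^sub>R \<ominus> ?y) \<oplus> (?y \<ominus> x)"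
  proof -
    have "?y [^] q\<^sub>R \<in> carrier R" using y by simp
    then have "?y [^] q\<^sub>R \<ominus> x = (?y [^] q\<^sub>R \<ominus> ?y) \<oplus> (?y \<ominus> x)" using x y by algebra
    then show ?thesis using \<open>x [^] (q\<^sub>R ^ Suc n) = ?y [^] q\<^sub>R\<close> by simp
  qed
  then show ?case
    using Suc pow_card_residue_field[OF y] ideal.axioms(1)[OF max_ideal_ideal] additive_subgroup.a_closed
    by metis
qed

text \<open>
  Such a \<open>t\<close> equals its powers with arbitrarily high exponent, and the maximal ideal is nilpotent.
\<close>

lemma rho_in_max_eq_zero:
  assumes t: "t \<in> rho R" "t \<in> max_ideal R"
  shows "t = \<zero>"
proof -
  obtain \<pi> where u: "uniformizer R \<pi>" using uniformizer_ex by blast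
  then have c: "\<pi> \<in> carrier R" using uniformizer_def by metis
  let ?a = "nilpotency_index R"
  have tc: "t \<in> carrier R" "t [^] q\<^sub>R = t" using t(1) unfolding rho_def by auto
  have "t [^] (q\<^sub>R ^ n) = t" for n
  proof (induction n)
    case (Suc n)
    have "t [^] (q\<^sub>R ^ Suc n) = (t [^] q\<^sub>R) [^] (q\<^sub>R ^ n)"
      using nat_pow_pow[OF tc(1), of "q\<^sub>R" "q\<^sub>R ^ n"] by simp
    also have "\<dots> = t" unfolding tc(2) by (rule Suc)
    finally show ?case .
  qed (use tc in simp)
  then have t': "t = t [^] (q\<^sub>R ^ ?a)" by simp
  obtain r where r: "r \<in> carrier R" "t = r \<otimes> \<pi>" using t(2) max_ideal_mem_iff[OF u] by blast
  have "?a \<le> q\<^sub>R ^ ?a" using power_gt_expt[of "q\<^sub>R" ?a] residue_card_gt_one by simp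
  then have "\<pi> [^] (q\<^sub>R ^ ?a) = \<zero>" using uniformizer_pow_eq_zero_iff[OF u] by blast
  then have "t [^] (q\<^sub>R ^ ?a) = \<zero>" using r c by (simp add: nat_pow_distrib)
  then show ?thesis using t' by simp
qed

end

section \<open>Values of polynomials of bounded degree\<close>

text \<open>
  Coefficient lists of the exact length \<open>n\<close>, with leading zeros allowed, stand for the polynomials
  of degree below \<open>n\<close>.
\<close>

definition (in ring) eval_span :: "'a set \<Rightarrow> 'a \<Rightarrow> nat \<Rightarrow> 'a set"
  where "eval_span K x n = {eval cs x | cs. length cs = n \<and> set cs \<subseteq> K}"

context cring
begin

lemma eval_map_mult:
  assumes "set cs \<subseteq> carrier R" "x \<in> carrier R" "c \<in> carrier R"
  shows "eval (map (\<lambda>d. c \<otimes> d) cs) x = c \<otimes> eval cs x"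
  using assms by (induction cs) (auto simp: eval_in_carrier r_distr m_assoc)

context
  fixes K x assumes K: "subring K R" and x: "x \<in> carrier R"
begin

lemma eval_span_carrier: "y \<in> eval_span K x n \<Longrightarrow> y \<in> carrier R"
  unfolding eval_span_def using eval_in_carrier x subringE(1)[OF K] by blast

lemma eval_span_0: "eval_span K x 0 = {\<zero>}"
  unfolding eval_span_def by auto

text \<open>
  One step of Horner's scheme.
\<close>

lemma eval_span_Suc_last:
  "y \<in> eval_span K x (Suc n) \<longleftrightarrow> (\<exists>t\<in>eval_span K x n. \<exists>g\<in>K. y = t \<otimes> x \<oplus> g)"
proof
  assume "y \<in> eval_span K x (Suc n)"
  then obtain cs where cs: "length cs = Suc n" "set cs \<subseteq> K" "y = eval cs x"
    unfolding eval_span_def by blast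
  then obtain ds g where "cs = ds @ [g]" by (metis length_0_conv nat.distinct(1) rev_exhaust)
  then show "\<exists>t\<in>eval_span K x n. \<exists>g\<in>K. y = t \<otimes> x \<oplus> g"
    using cs eval_append_aux[of ds g x] x subringE(1)[OF K] unfolding eval_span_def by force
next
  assume "\<exists>t\<in>eval_span K x n. \<exists>g\<in>K. y = t \<otimes> x \<oplus> g"
  then obtain ds g where ds: "length ds = n" "set ds \<subseteq> K" "g \<in> K" "y = eval ds x \<otimes> x \<oplus> g"
    unfolding eval_span_def by blast
  have "set ds \<subseteq> carrier R" "g \<in> carrier R" using ds subringE(1)[OF K] by auto
  then have "y = eval (ds @ [g]) x" "length (ds @ [g]) = Suc n" "set (ds @ [g]) \<subseteq> K"
    using eval_append_aux[of ds g x] x ds by auto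
  then show "y \<in> eval_span K x (Suc n)" unfolding eval_span_def by blast
qed

text \<open>
  Splitting off the leading term instead is what reduction by a monic polynomial and expansion
  by successive approximation use.
\<close>

lemma eval_span_Suc_first:
  "y \<in> eval_span K x (Suc n) \<longleftrightarrow> (\<exists>t\<in>eval_span K x n. \<exists>g\<in>K. y = g \<otimes> x [^] n \<oplus> t)"
proof
  assume "y \<in> eval_span K x (Suc n)"
  then obtain cs where cs: "length cs = Suc n" "set cs \<subseteq> K" "y = eval cs x"
    unfolding eval_span_def by blast
  then obtain ds g where "cs = g # ds" by (metis length_Suc_conv)
  then show "\<exists>t\<in>eval_span K x n. \<exists>g\<in>K. y = g \<otimes> x [^] n \<oplus> t"
    using cs unfolding eval_span_def by force
next
  assume "\<exists>t\<in>eval_span K x n. \<exists>g\<in>K. y = g \<otimes> x [^] n \<oplus> t"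
  then obtain ds g where ds: "length ds = n" "set ds \<subseteq> K" "g \<in> K" "y = g \<otimes> x [^] n \<oplus> eval ds x"
    unfolding eval_span_def by blast
  then have "y = eval (g # ds) x" "length (g # ds) = Suc n" "set (g # ds) \<subseteq> K"
    by auto
  then show "y \<in> eval_span K x (Suc n)" unfolding eval_span_def by blast
qed

lemma eval_span_mono_Suc: "y \<in> eval_span K x n \<Longrightarrow> y \<in> eval_span K x (Suc n)"
  unfolding eval_span_Suc_first
  using subringE(2)[OF K] eval_span_carrier x by (intro bexI[of _ y] bexI[of _ \<zero>]) auto

lemma eval_span_mult_x: "y \<in> eval_span K x n \<Longrightarrow> y \<otimes> x \<in> eval_span K x (Suc n)"
  unfolding eval_span_Suc_last
  using subringE(2)[OF K] eval_span_carrier x by (intro bexI[of _ y] bexI[of _ \<zero>]) auto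

lemma eval_span_zero: "\<zero> \<in> eval_span K x n"
  by (induction n) (auto simp: eval_span_0 eval_span_mono_Suc)

lemma eval_span_add:
  "y \<in> eval_span K x n \<Longrightarrow> z \<in> eval_span K x n \<Longrightarrow> y \<oplus> z \<in> eval_span K x n"
proof (induction n arbitrary: y z)
  case 0
  then show ?case by (simp add: eval_span_0)
next
  case (Suc n)
  obtain t g where t: "t \<in> eval_span K x n" "g \<in> K" "y = t \<otimes> x \<oplus> g"
    using Suc.prems(1) eval_span_Suc_last by blast
  obtain s h where s: "s \<in> eval_span K x n" "h \<in> K" "z = s \<otimes> x \<oplus> h"
    using Suc.prems(2) eval_span_Suc_last by blast
  have c: "t \<in> carrier R" "s \<in> carrier R" "g \<in> carrier R" "h \<in> carrier R"
    using t s eval_span_carrier subringE(1)[OF K] by auto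
  have "y \<oplus> z = (t \<oplus> s) \<otimes> x \<oplus> (g \<oplus> h)"
    unfolding t(3) s(3) using c x by (simp add: l_distr a_ac)
  then show ?case
    unfolding eval_span_Suc_last using Suc.IH[OF t(1) s(1)] subringE(7)[OF K t(2) s(2)] by blast
qed

lemma eval_span_smult:
  assumes "c \<in> K" "y \<in> eval_span K x n"
  shows "c \<otimes> y \<in> eval_span K x n"
proof -
  obtain cs where cs: "length cs = n" "set cs \<subseteq> K" "y = eval cs x"
    using assms(2) unfolding eval_span_def by blast
  have "set cs \<subseteq> carrier R" "c \<in> carrier R" using cs(2) assms(1) subringE(1)[OF K] by auto
  then have "c \<otimes> y = eval (map (\<lambda>d. c \<otimes> d) cs) x"
    using eval_map_mult[of cs x c] x cs(3) by simp
  moreover have "set (map (\<lambda>d. c \<otimes> d) cs) \<subseteq> K"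
    using cs assms(1) subringE(6)[OF K] by auto
  ultimately show ?thesis unfolding eval_span_def using cs(1) by (metis (mono_tags, lifting) length_map mem_Collect_eq)
qed

lemma eval_span_neg:
  assumes y: "y \<in> eval_span K x n"
  shows "\<ominus> y \<in> eval_span K x n"
proof -
  have "\<ominus> y = (\<ominus> \<one>) \<otimes> y" using eval_span_carrier[OF y] by (simp add: l_minus)
  then show ?thesis using eval_span_smult[OF subringE(5)[OF K subringE(3)[OF K]] y] by simp
qed

lemma eval_span_const: "0 < n \<Longrightarrow> c \<in> K \<Longrightarrow> c \<in> eval_span K x n"
proof (induction n)
  case (Suc n)
  have "c = \<zero> \<otimes> x \<oplus> c" using Suc.prems x subringE(1)[OF K] by auto
  then show ?case unfolding eval_span_Suc_last using Suc.prems eval_span_zero by blast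
qed simp

text \<open>
  Multiplication by \<open>x\<close> moves the leading term to degree \<open>e\<close>, where the hypothesis on \<open>x\<^sup>e\<close>
  brings it back to lower degree.
\<close>

lemma eval_span_closed_mult_x:
  assumes xe: "x [^] e \<in> eval_span K x e" and y: "y \<in> eval_span K x e"
  shows "y \<otimes> x \<in> eval_span K x e"
proof (cases e)
  case 0
  then show ?thesis using y x by (simp add: eval_span_0)
next
  case (Suc m)
  then obtain t g where t: "t \<in> eval_span K x m" "g \<in> K" "y = g \<otimes> x [^] m \<oplus> t"
    using y eval_span_Suc_first by blast
  have c: "g \<in> carrier R" "t \<in> carrier R" using t eval_span_carrier subringE(1)[OF K] by auto
  then have "y \<otimes> x = g \<otimes> x [^] e \<oplus> t \<otimes> x"
    unfolding t(3) Suc using x by (simp add: l_distr m_assoc)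
  moreover have "t \<otimes> x \<in> eval_span K x e" using eval_span_mult_x[OF t(1)] Suc by simp
  ultimately show ?thesis using eval_span_add eval_span_smult[OF t(2) xe] by simp
qed

lemma eval_span_mult:
  assumes xe: "x [^] e \<in> eval_span K x e" and y: "y \<in> eval_span K x n" and z: "z \<in> eval_span K x e"
  shows "y \<otimes> z \<in> eval_span K x e"
  using y
proof (induction n arbitrary: y)
  case 0
  then show ?case using eval_span_carrier[OF z] by (simp add: eval_span_0 eval_span_zero)
next
  case (Suc n)
  then obtain t g where t: "t \<in> eval_span K x n" "g \<in> K" "y = t \<otimes> x \<oplus> g"
    using eval_span_Suc_last by blast
  have c: "g \<in> carrier R" "t \<in> carrier R" "z \<in> carrier R"
    using t z eval_span_carrier subringE(1)[OF K] by auto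
  have "y \<otimes> z = (t \<otimes> z) \<otimes> x \<oplus> g \<otimes> z"
    unfolding t(3) using c x by algebra
  then show ?case
    using eval_span_add eval_span_smult[OF t(2) z] eval_span_closed_mult_x[OF xe] Suc.IH[OF t(1)] by simp
qed

lemma eval_span_subring:
  assumes "0 < e" and xe: "x [^] e \<in> eval_span K x e"
  shows "subring (eval_span K x e) R"
  using assms(1) eval_span_carrier eval_span_neg eval_span_add eval_span_mult[OF xe]
    eval_span_const[OF _ subringE(3)[OF K]]
  by (intro subringI) auto

text \<open>
  In a Horner step \<open>y = t x + g\<close> with \<open>t\<close> of degree below \<open>n\<close>, the exponent of \<open>g\<close> is divisible by
  \<open>e\<close>, while that of \<open>t x\<close> is congruent to one of \<open>1, \<dots>, n\<close> modulo \<open>e\<close>, all of them below \<open>e\<close>.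
  So the exponents differ, and the smaller one can be factored out: what remains is a unit
  plus a multiple of \<open>x\<close>. Powers of \<open>x\<close> may vanish here; the statement is about a representation
  and not about a valuation.
\<close>

lemma eval_span_unit_times_power:
  assumes unit_add: "\<And>u r. u \<in> Units R \<Longrightarrow> r \<in> carrier R \<Longrightarrow> u \<oplus> r \<otimes> x \<in> Units R"
    and val: "\<And>c. c \<in> K \<Longrightarrow> c = \<zero> \<or> (\<exists>u\<in>Units R. \<exists>j. c = u \<otimes> x [^] (e * j))"
    and "n \<le> e" and "y \<in> eval_span K x n"
  shows "y = \<zero> \<or> (\<exists>u\<in>Units R. \<exists>j i. i < n \<and> y = u \<otimes> x [^] (e * j + i))"
  using assms(3,4)
proof (induction n arbitrary: y)
  case 0
  then show ?case by (simp add: eval_span_0)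
next
  case (Suc n)
  then obtain t g where t: "t \<in> eval_span K x n" "g \<in> K" "y = t \<otimes> x \<oplus> g"
    using eval_span_Suc_last by blast
  have c: "g \<in> carrier R" "t \<in> carrier R"
    using t eval_span_carrier subringE(1)[OF K] by auto
  have sep: "\<exists>w\<in>Units R. u \<otimes> x [^] k \<oplus> v \<otimes> x [^] l = w \<otimes> x [^] k"
    if "k < l" "u \<in> Units R" "v \<in> Units R" for k l :: nat and u v
  proof -
    obtain d where d: "l = k + Suc d" using less_imp_Suc_add[OF \<open>k < l\<close>] by auto
    have "x [^] l = x [^] k \<otimes> (x [^] d \<otimes> x)"
      using nat_pow_mult[OF x, of k "Suc d"] unfolding d by simp
    moreover have "u \<otimes> x [^] k \<oplus> v \<otimes> (x [^] k \<otimes> (x [^] d \<otimes> x))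
        = (u \<oplus> (v \<otimes> x [^] d) \<otimes> x) \<otimes> x [^] k"
      using that(2,3)[THEN Units_closed] x nat_pow_closed[OF x, of k] nat_pow_closed[OF x, of d]
      by algebra
    ultimately have "u \<otimes> x [^] k \<oplus> v \<otimes> x [^] l = (u \<oplus> (v \<otimes> x [^] d) \<otimes> x) \<otimes> x [^] k"
      by simp
    moreover have "u \<oplus> (v \<otimes> x [^] d) \<otimes> x \<in> Units R"
      using unit_add[OF that(2)] Units_closed[OF that(3)] x by simp
    ultimately show ?thesis by blast
  qed
  consider "t = \<zero>" "g = \<zero>" | u j where "t = \<zero>" "u \<in> Units R" "g = u \<otimes> x [^] (e * j)"
    | v k i where "g = \<zero>" "v \<in> Units R" "i < n" "t = v \<otimes> x [^] (e * k + i)"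
    | u j v k i where "u \<in> Units R" "g = u \<otimes> x [^] (e * j)" "v \<in> Units R" "i < n" "t = v \<otimes> x [^] (e * k + i)"
    using Suc.IH[OF _ t(1)] Suc.prems(1) val[OF t(2)] by (meson Suc_leD)
  then show ?case
  proof cases
    case 1
    then show ?thesis using t(3) x by simp
  next
    case 2
    then have "y = u \<otimes> x [^] (e * j + 0)" using t(3) c x by simp
    then show ?thesis using 2(2) by blast
  next
    case 3
    then have "y = v \<otimes> x [^] (e * k + Suc i)" using t(3) c x Units_closed[OF 3(2)] by (simp add: m_assoc)
    then show ?thesis using 3(2,3) by blast
  next
    case 4
    have tx: "t \<otimes> x = v \<otimes> x [^] (e * k + Suc i)" using 4 x Units_closed[OF 4(3)] by (simp add: m_assoc)
    have "e * j \<noteq> e * k + Suc i"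
    proof
      assume eq: "e * j = e * k + Suc i"
      have "Suc i < e" using 4(4) Suc.prems(1) by simp
      then have "(e * k + Suc i) mod e = Suc i" by simp
      moreover have "(e * j) mod e = 0" by simp
      ultimately show False using eq by simp
    qed
    then consider "e * j < e * k + Suc i" | "e * k + Suc i < e * j" by linarith
    then show ?thesis
    proof cases
      case 1
      obtain w where "w \<in> Units R" "u \<otimes> x [^] (e * j) \<oplus> v \<otimes> x [^] (e * k + Suc i) = w \<otimes> x [^] (e * j)"
        using sep[OF 1 4(1,3)] by blast
      then have "y = w \<otimes> x [^] (e * j + 0)"
        using t(3) tx 4(2) c x by (metis a_comm add.right_neutral m_closed)
      then show ?thesis using \<open>w \<in> Units R\<close> by blast
    next
      case 2
      obtain w where "w \<in> Units R"
        "v \<otimes> x [^] (e * k + Suc i) \<oplus> u \<otimes> x [^] (e * j) = w \<otimes> x [^] (e * k + Suc i)"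
        using sep[OF 2 4(3,1)] by blast
      then have "y = w \<otimes> x [^] (e * k + Suc i)"
        using t(3) tx 4(2) by metis
      then show ?thesis using \<open>w \<in> Units R\<close> 4(4) by blast
    qed
  qed
qed

end
end

section \<open>The coefficient ring\<close>

context finite_local_pir
begin

lemma rho_subset: "rho R \<subseteq> carrier R"
  unfolding rho_def by auto

lemma carrier_coeff_ring: "carrier (coeff_ring R) = generate_ring R (rho R)"
  unfolding coeff_ring_def by simp

lemma coeff_subring: "subring (carrier (coeff_ring R)) R"
  unfolding carrier_coeff_ring by (rule generate_ring_is_subring[OF rho_subset])

lemma coeff_closed: "x \<in> carrier (coeff_ring R) \<Longrightarrow> x \<in> carrier R"
  using subringE(1)[OF coeff_subring] by blast

lemma coeff_ring_ops [simp]: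
  "\<one>\<^bsub>coeff_ring R\<^esub> = \<one>" "\<zero>\<^bsub>coeff_ring R\<^esub> = \<zero>" "x \<oplus>\<^bsub>coeff_ring R\<^esub> y = x \<oplus> y"
  "x \<otimes>\<^bsub>coeff_ring R\<^esub> y = x \<otimes> y" "x [^]\<^bsub>coeff_ring R\<^esub> n = x [^] (n::nat)"
  "[(n::nat)] \<cdot>\<^bsub>coeff_ring R\<^esub> x = [n] \<cdot> x"
  unfolding coeff_ring_def by (simp_all add: nat_pow_def add_pow_def)

lemma coeff_ring_cring: "cring (coeff_ring R)"
proof -
  have "coeff_ring R = R\<lparr>carrier := carrier (coeff_ring R)\<rparr>" by (simp add: coeff_ring_def)
  then show ?thesis
    using subcringI'[OF coeff_subring] subcring_iff[of "carrier (coeff_ring R)"] coeff_closed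
    by (metis subsetI)
qed

lemma char_elem_coeff: "char_elem R \<in> carrier (coeff_ring R)"
proof -
  have "[n] \<cdot> \<one> \<in> carrier (coeff_ring R)" for n :: nat
    by (induction n) (auto intro: subringE(2,3,7)[OF coeff_subring])
  then show ?thesis unfolding char_elem_def .
qed

lemma char_elem_nilpotent: "char_elem R [^] nilpotency_index R = \<zero>"
proof -
  obtain \<pi> where u: "uniformizer R \<pi>" using uniformizer_ex by blast
  then have c: "\<pi> \<in> carrier R" using uniformizer_def by metis
  obtain d where d: "d \<in> carrier R" "char_elem R = d \<otimes> \<pi>"
    using char_elem_in_max max_ideal_mem_iff[OF u] by blast
  show ?thesis using d c uniformizer_pow_eq_zero_iff[OF u, of "nilpotency_index R"]
    by (simp add: nat_pow_distrib)
qed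

lemma coeff_PIdl_iff:
  "x \<in> PIdl\<^bsub>coeff_ring R\<^esub> c \<longleftrightarrow> (\<exists>z\<in>carrier (coeff_ring R). x = z \<otimes> c)"
  unfolding cgenideal_def by auto

text \<open>
  The congruence \<open>x\<^sup>q \<equiv> x\<close> modulo \<open>p\<close> holds with equality for the generators, and it passes to
  sums because raising to the power \<open>q\<close> is additive modulo \<open>p\<close>. The multiple of \<open>p\<close> is taken inside the
  coefficient ring, which is why the Frobenius lemma is applied to that ring and not to \<open>R\<close>.
\<close>

lemma coeff_pow_card_congruence:
  assumes "x \<in> carrier (coeff_ring R)"
  shows "\<exists>z\<in>carrier (coeff_ring R). x [^] q\<^sub>R = x \<oplus> char_elem R \<otimes> z"
proof -
  interpret L: cring "coeff_ring R" by (rule coeff_ring_cring)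
  let ?K = "carrier (coeff_ring R)" and ?c = "char_elem R"
  have fr: "\<exists>w\<in>?K. (x \<oplus> y) [^] q\<^sub>R = x [^] q\<^sub>R \<oplus> y [^] q\<^sub>R \<oplus> ?c \<otimes> w" if "x \<in> ?K" "y \<in> ?K" for x y
    using L.frobenius_power_add[OF residue_char_prime that] by (simp add: char_elem_def)
  have add: "\<exists>z\<in>?K. (x \<oplus> y) [^] q\<^sub>R = (x \<oplus> y) \<oplus> ?c \<otimes> z"
    if xy: "x \<in> ?K" "y \<in> ?K" and z: "z1 \<in> ?K" "z2 \<in> ?K"
      "x [^] q\<^sub>R = x \<oplus> ?c \<otimes> z1" "y [^] q\<^sub>R = y \<oplus> ?c \<otimes> z2" for x y z1 z2
  proof -
    obtain w where w: "w \<in> ?K" "(x \<oplus> y) [^] q\<^sub>R = x [^] q\<^sub>R \<oplus> y [^] q\<^sub>R \<oplus> ?c \<otimes> w"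
      using fr[OF xy] by blast
    note cl = xy[THEN coeff_closed] z(1,2)[THEN coeff_closed] coeff_closed[OF w(1)] char_elem_closed
    have "(x \<oplus> y) [^] q\<^sub>R = (x \<oplus> y) \<oplus> ?c \<otimes> (z1 \<oplus> z2 \<oplus> w)"
      unfolding w(2) z(3,4) using cl by (simp add: r_distr a_ac)
    moreover have "z1 \<oplus> z2 \<oplus> w \<in> ?K"
      using z(1,2) w(1) subringE(7)[OF coeff_subring] by blast
    ultimately show ?thesis by blast
  qed
  have "x \<in> generate_ring R (rho R)" using assms carrier_coeff_ring by simp
  then have "x \<in> ?K \<and> (\<exists>z\<in>?K. x [^] q\<^sub>R = x \<oplus> ?c \<otimes> z)"
  proof (induction rule: generate_ring.induct)
    case one
    show ?case using subringE(2,3)[OF coeff_subring] char_elem_closed by (intro conjI bexI[of _ \<zero>]) auto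
  next
    case (incl h)
    then have "h \<in> carrier R" "h [^] q\<^sub>R = h" unfolding rho_def by auto
    then have "h [^] q\<^sub>R = h \<oplus> ?c \<otimes> \<zero>" using char_elem_closed by simp
    moreover have "h \<in> ?K"
      unfolding carrier_coeff_ring using incl by (rule generate_ring.incl)
    ultimately show ?case using subringE(2)[OF coeff_subring] by blast
  next
    case (a_inv h)
    then obtain z where z: "h \<in> ?K" "z \<in> ?K" "h [^] q\<^sub>R = h \<oplus> ?c \<otimes> z" by blast
    have m: "\<ominus> h \<in> ?K" using z subringE(5)[OF coeff_subring] by blast
    obtain w where w: "w \<in> ?K" "(h \<oplus> \<ominus> h) [^] q\<^sub>R = h [^] q\<^sub>R \<oplus> (\<ominus> h) [^] q\<^sub>R \<oplus> ?c \<otimes> w"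
      using fr[OF z(1) m] by blast
    note cl = z(1,2)[THEN coeff_closed] coeff_closed[OF w(1)] coeff_closed[OF m] char_elem_closed
    have "\<zero> [^] q\<^sub>R = \<zero>" by (rule nat_pow_zero[OF gr_implies_not0[OF residue_card_gt_one]])
    then have eq: "\<zero> = (h \<oplus> ?c \<otimes> z) \<oplus> (\<ominus> h) [^] q\<^sub>R \<oplus> ?c \<otimes> w"
      using w(2) z(3) cl by (simp add: r_neg)
    have "y = \<ominus> h \<oplus> ?c \<otimes> (\<ominus> (z \<oplus> w))"
      if "\<zero> = (h \<oplus> ?c \<otimes> z) \<oplus> y \<oplus> ?c \<otimes> w" "y \<in> carrier R" for y
    proof -
      have "y = ((h \<oplus> ?c \<otimes> z) \<oplus> y \<oplus> ?c \<otimes> w) \<oplus> (\<ominus> h \<oplus> ?c \<otimes> (\<ominus> (z \<oplus> w)))"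
        using cl that(2) by algebra
      also have "\<dots> = \<ominus> h \<oplus> ?c \<otimes> (\<ominus> (z \<oplus> w))"
        unfolding that(1)[symmetric] using cl by simp
      finally show ?thesis .
    qed
    then have "(\<ominus> h) [^] q\<^sub>R = \<ominus> h \<oplus> ?c \<otimes> (\<ominus> (z \<oplus> w))" using eq cl by simp
    moreover have "\<ominus> (z \<oplus> w) \<in> ?K" using z w subringE(5,7)[OF coeff_subring] by blast
    ultimately show ?case using m by blast
  next
    case (eng_add h1 h2)
    then show ?case using add subringE(7)[OF coeff_subring] by blast
  next
    case (eng_mult h1 h2)
    then obtain z1 z2 where z: "h1 \<in> ?K" "h2 \<in> ?K" "z1 \<in> ?K" "z2 \<in> ?K"
      "h1 [^] q\<^sub>R = h1 \<oplus> ?c \<otimes> z1" "h2 [^] q\<^sub>R = h2 \<oplus> ?c \<otimes> z2" by blast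
    note cl = z(1-4)[THEN coeff_closed] char_elem_closed
    have "(h1 \<otimes> h2) [^] q\<^sub>R = (h1 \<oplus> ?c \<otimes> z1) \<otimes> (h2 \<oplus> ?c \<otimes> z2)"
      using cl z(5,6) by (simp add: nat_pow_distrib)
    also have "\<dots> = h1 \<otimes> h2 \<oplus> ?c \<otimes> (h1 \<otimes> z2 \<oplus> z1 \<otimes> h2 \<oplus> ?c \<otimes> z1 \<otimes> z2)"
      using cl by algebra
    finally have "(h1 \<otimes> h2) [^] q\<^sub>R = h1 \<otimes> h2 \<oplus> ?c \<otimes> (h1 \<otimes> z2 \<oplus> z1 \<otimes> h2 \<oplus> ?c \<otimes> z1 \<otimes> z2)" .
    moreover have "h1 \<otimes> z2 \<oplus> z1 \<otimes> h2 \<oplus> ?c \<otimes> z1 \<otimes> z2 \<in> ?K"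
      by (intro subringE(6,7)[OF coeff_subring] z(1-4) char_elem_coeff)
    ultimately show ?case using z(1,2) subringE(6)[OF coeff_subring z(1,2)] by blast
  qed
  then show ?thesis by blast
qed

lemma coeff_teichmueller_congruence:
  assumes "x \<in> carrier (coeff_ring R)"
  shows "\<exists>z\<in>carrier (coeff_ring R). x [^] (q\<^sub>R ^ n) = x \<oplus> char_elem R \<otimes> z"
proof (induction n)
  case 0
  show ?case using subringE(2)[OF coeff_subring] char_elem_closed coeff_closed[OF assms]
    by (auto intro!: bexI[of _ \<zero>])
next
  case (Suc n)
  then obtain z where z: "z \<in> carrier (coeff_ring R)" "x [^] (q\<^sub>R ^ n) = x \<oplus> char_elem R \<otimes> z"
    by blast
  interpret L: cring "coeff_ring R" by (rule coeff_ring_cring)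
  have "x [^] (q\<^sub>R ^ n) \<in> carrier (coeff_ring R)"
    using L.nat_pow_closed[OF assms, of "q\<^sub>R ^ n"] by simp
  then obtain w where w: "w \<in> carrier (coeff_ring R)"
      "(x [^] (q\<^sub>R ^ n)) [^] q\<^sub>R = x [^] (q\<^sub>R ^ n) \<oplus> char_elem R \<otimes> w"
    using coeff_pow_card_congruence by blast
  have "x [^] (q\<^sub>R ^ Suc n) = (x [^] (q\<^sub>R ^ n)) [^] q\<^sub>R"
    using coeff_closed[OF assms] by (simp add: nat_pow_pow mult.commute)
  also have "\<dots> = x [^] (q\<^sub>R ^ n) \<oplus> char_elem R \<otimes> w" by (rule w(2))
  also have "\<dots> = x \<oplus> char_elem R \<otimes> (z \<oplus> w)"
    unfolding z(2) using coeff_closed[OF assms] coeff_closed[OF z(1)] coeff_closed[OF w(1)] char_elem_closed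
    by (simp add: r_distr a_assoc)
  finally show ?case using subringE(7)[OF coeff_subring z(1) w(1)] by blast
qed

text \<open>
  Modulo \<open>p\<close> the element \<open>x\<close> is congruent to a Teichmueller representative, which is zero or a unit.
\<close>

lemma coeff_unit_or_multiple:
  assumes x: "x \<in> carrier (coeff_ring R)"
  shows "x \<in> Units R \<or> (\<exists>z\<in>carrier (coeff_ring R). x = z \<otimes> char_elem R)"
proof -
  let ?t = "x [^] (q\<^sub>R ^ nilpotency_index R)"
  obtain z where z: "z \<in> carrier (coeff_ring R)" "?t = x \<oplus> char_elem R \<otimes> z"
    using coeff_teichmueller_congruence[OF x] by blast
  note cl = coeff_closed[OF x] coeff_closed[OF z(1)] char_elem_closed
  have m: "\<ominus> z \<in> carrier (coeff_ring R)" using z subringE(5)[OF coeff_subring] by blast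
  have tr: "?t \<in> rho R" using teichmueller_fixed cl by blast
  have "x = (x \<oplus> char_elem R \<otimes> z) \<oplus> (\<ominus> z) \<otimes> char_elem R" using cl by algebra
  then have eq: "x = ?t \<oplus> (\<ominus> z) \<otimes> char_elem R" using z(2) by simp
  show ?thesis
  proof (cases "?t \<in> max_ideal R")
    case True
    then have "?t = \<zero>" using rho_in_max_eq_zero tr by blast
    then have "x = (\<ominus> z) \<otimes> char_elem R" using eq cl by simp
    then show ?thesis using m by blast
  next
    case False
    then have "?t \<in> Units R" using Units_iff_notin_max tr rho_subset by blast
    moreover have "(\<ominus> z) \<otimes> char_elem R \<in> max_ideal R"
      using char_elem_in_max cl ideal.I_l_closed[OF max_ideal_ideal] by simp
    ultimately show ?thesis using eq Units_plus_max_ideal by metis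
  qed
qed

lemma coeff_unit_iff:
  assumes x: "x \<in> carrier (coeff_ring R)"
  shows "x \<in> Units R \<longleftrightarrow> x \<notin> PIdl\<^bsub>coeff_ring R\<^esub> (char_elem R)"
proof -
  have "z \<otimes> char_elem R \<notin> Units R" if "z \<in> carrier (coeff_ring R)" for z
    using Units_iff_notin_max char_elem_in_max ideal.I_l_closed[OF max_ideal_ideal] coeff_closed[OF that] by blast
  then show ?thesis using coeff_unit_or_multiple[OF x] unfolding coeff_PIdl_iff by auto
qed

text \<open>
  Factors \<open>p\<close> are split off until the cofactor is a unit; \<open>p\<close> is nilpotent, so this ends.
\<close>

lemma coeff_unit_times_char_power:
  assumes x: "x \<in> carrier (coeff_ring R)"
  shows "\<exists>u\<in>Units R \<inter> carrier (coeff_ring R). \<exists>j. x = u \<otimes> char_elem R [^] (j::nat)"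
proof -
  have c: "char_elem R \<in> carrier R" by (rule char_elem_closed)
  have "(\<exists>u\<in>Units R \<inter> carrier (coeff_ring R). \<exists>j. x = u \<otimes> char_elem R [^] (j::nat))
    \<or> (\<exists>z\<in>carrier (coeff_ring R). x = z \<otimes> char_elem R [^] n)" for n :: nat
  proof (induction n)
    case 0
    then show ?case using x coeff_closed[OF x] by (auto intro!: bexI[of _ x])
  next
    case (Suc n)
    show ?case
    proof (rule disjCI)
      assume n: "\<not> (\<exists>z\<in>carrier (coeff_ring R). x = z \<otimes> char_elem R [^] Suc n)"
      show "\<exists>u\<in>Units R \<inter> carrier (coeff_ring R). \<exists>j. x = u \<otimes> char_elem R [^] (j::nat)"
      proof (rule ccontr)
        assume h: "\<not> (\<exists>u\<in>Units R \<inter> carrier (coeff_ring R). \<exists>j. x = u \<otimes> char_elem R [^] (j::nat))"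
        then obtain r where r: "r \<in> carrier (coeff_ring R)" "x = r \<otimes> char_elem R [^] n" using Suc by auto
        then have "r \<notin> Units R" using h by auto
        then obtain s where s: "s \<in> carrier (coeff_ring R)" "r = s \<otimes> char_elem R"
          using r coeff_unit_or_multiple by blast
        have "x = s \<otimes> char_elem R [^] Suc n"
          using r s c coeff_closed by (simp add: m_ac)
        then show False using n s(1) by blast
      qed
    qed
  qed
  then consider "\<exists>u\<in>Units R \<inter> carrier (coeff_ring R). \<exists>j. x = u \<otimes> char_elem R [^] (j::nat)"
    | z where "z \<in> carrier (coeff_ring R)" "x = z \<otimes> char_elem R [^] nilpotency_index R" by blast
  then show ?thesis
  proof cases
    case 2
    then have "x = \<one> \<otimes> char_elem R [^] nilpotency_index R"
      using char_elem_nilpotent coeff_closed by simp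
    then show ?thesis using subringE(3)[OF coeff_subring] by blast
  qed
qed

text \<open>
  Teichmueller representatives give the first \<open>e\<close> digits of a \<open>\<pi>\<close>-adic expansion, with a remainder
  divisible by \<open>\<pi>\<^sup>e\<close> and hence by \<open>p\<close>. Expanding the cofactor of \<open>p\<close> again and again collects the
  digits into coefficients from the coefficient ring, until a power of \<open>p\<close> vanishes.
\<close>

lemma eval_span_uniformizer:
  assumes u: "uniformizer R \<pi>" and w: "w \<in> Units R" "char_elem R = w \<otimes> \<pi> [^] e"
    and y: "y \<in> carrier R"
  shows "y \<in> eval_span (carrier (coeff_ring R)) \<pi> e"
proof -
  let ?K = "carrier (coeff_ring R)" and ?c = "char_elem R"
  have c: "\<pi> \<in> carrier R" using u uniformizer_def by metis
  note K = coeff_subring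
  \<comment> \<open>\<open>n\<close> digits of the \<open>\<pi>\<close>-adic expansion\<close>
  have step1: "\<exists>s\<in>eval_span ?K \<pi> n. \<exists>r\<in>carrier R. y = s \<oplus> r \<otimes> \<pi> [^] n"
    if "y \<in> carrier R" for y n
  proof (induction n)
    case 0
    then show ?case using that by (auto simp: eval_span_0[OF K c])
  next
    case (Suc n)
    then obtain s r where s: "s \<in> eval_span ?K \<pi> n" "r \<in> carrier R" "y = s \<oplus> r \<otimes> \<pi> [^] n" by blast
    define t where "t = r [^] (q\<^sub>R ^ nilpotency_index R)"
    have t: "t \<in> rho R" "t \<in> ?K" "t \<in> carrier R"
      using teichmueller_fixed[OF s(2)] rho_subset unfolding t_def carrier_coeff_ring
      by (auto intro: generate_ring.incl)
    obtain d where d: "d \<in> carrier R" "t \<ominus> r = d \<otimes> \<pi>"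
      using teichmueller_congruent[OF s(2)] max_ideal_mem_iff[OF u] unfolding t_def by blast
    have sc: "s \<in> carrier R" using eval_span_carrier[OF K c s(1)] .
    have "r = t \<oplus> (\<ominus> (t \<ominus> r))" using s(2) t(3) by algebra
    then have r: "r = t \<oplus> (\<ominus> d) \<otimes> \<pi>" using d c by (simp add: l_minus)
    have "y = s \<oplus> (t \<oplus> (\<ominus> d) \<otimes> \<pi>) \<otimes> \<pi> [^] n"
      using s(3) r by simp
    also have "\<dots> = (t \<otimes> \<pi> [^] n \<oplus> s) \<oplus> (\<ominus> d) \<otimes> (\<pi> [^] n \<otimes> \<pi>)"
      using sc t(3) d(1) c nat_pow_closed[OF c, of n] by algebra
    finally have "y = (t \<otimes> \<pi> [^] n \<oplus> s) \<oplus> (\<ominus> d) \<otimes> \<pi> [^] Suc n"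
      by simp
    moreover have "t \<otimes> \<pi> [^] n \<oplus> s \<in> eval_span ?K \<pi> (Suc n)"
      using eval_span_Suc_first[OF K c] s(1) t(2) by blast
    ultimately show ?case using d(1) by blast
  qed
  \<comment> \<open>modulo \<open>p\<^sup>n\<close>, every element is the value of a polynomial of degree below \<open>e\<close>\<close>
  have step2: "\<exists>s\<in>eval_span ?K \<pi> e. \<exists>r\<in>carrier R. y = s \<oplus> ?c [^] n \<otimes> r" for n :: nat
  proof (induction n)
    case 0
    have "y = \<zero> \<oplus> ?c [^] (0::nat) \<otimes> y" using y by simp
    then show ?case using y eval_span_zero[OF K c] by blast
  next
    case (Suc n)
    then obtain s r where s: "s \<in> eval_span ?K \<pi> e" "r \<in> carrier R" "y = s \<oplus> ?c [^] n \<otimes> r" by blast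
    obtain s' r' where s': "s' \<in> eval_span ?K \<pi> e" "r' \<in> carrier R" "r = s' \<oplus> r' \<otimes> \<pi> [^] e"
      using step1[OF s(2)] by blast
    have pe: "\<pi> [^] e = inv w \<otimes> ?c" using w c Units_closed[OF w(1)] by (simp add: m_assoc[symmetric])
    note cl = eval_span_carrier[OF K c s(1)] eval_span_carrier[OF K c s'(1)] s'(2) char_elem_closed
    have "y = (s \<oplus> ?c [^] n \<otimes> s') \<oplus> ?c [^] Suc n \<otimes> (r' \<otimes> inv w)"
      unfolding s(3) s'(3) pe using cl w(1) by (simp add: r_distr m_ac a_ac)
    moreover interpret L: cring "coeff_ring R" by (rule coeff_ring_cring)
    have "?c [^] n \<in> ?K" using L.nat_pow_closed[OF char_elem_coeff, of n] by simp
    then have "s \<oplus> ?c [^] n \<otimes> s' \<in> eval_span ?K \<pi> e"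
      using eval_span_add[OF K c s(1)] eval_span_smult[OF K c _ s'(1)] by blast
    moreover have "r' \<otimes> inv w \<in> carrier R" using s'(2) w(1) by simp
    ultimately show ?case by blast
  qed
  obtain s r where "s \<in> eval_span ?K \<pi> e" "r \<in> carrier R"
    "y = s \<oplus> ?c [^] nilpotency_index R \<otimes> r" using step2 by blast
  then show ?thesis using char_elem_nilpotent eval_span_carrier[OF K c] by simp
qed

end

section \<open>Eisenstein polynomials and uniformizers\<close>

lemma (in ring) eval_in_ideal:
  assumes "ideal I R" "set cs \<subseteq> I" "x \<in> carrier R"
  shows "eval cs x \<in> I"
proof -
  interpret ideal I R by fact
  show ?thesis using assms(2,3) by (induction cs) (auto intro!: I_r_closed)
qed

context finite_local_pir
begin

lemma ram_index_pos:
  assumes "ram_index R < nilpotency_index R"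
  shows "0 < ram_index R"
proof (rule ccontr)
  assume "\<not> 0 < ram_index R"
  moreover obtain \<pi> w where "uniformizer R \<pi>" "w \<in> Units R" "char_elem R = w \<otimes> \<pi> [^] ram_index R"
    using uniformizer_ex char_elem_unit_times_power assms by blast
  ultimately have "char_elem R \<in> Units R" by simp
  then show False using char_elem_in_max Units_iff_notin_max by blast
qed

lemma char_elem_nonzero:
  "ram_index R < nilpotency_index R \<Longrightarrow> char_elem R \<noteq> \<zero>"
  unfolding ram_index_def ord_max_def by auto

text \<open>
  This form exposes the leading coefficient as the head of the list, so that evaluation at a zero
  \<open>x\<close> yields an equation for \<open>x\<^sup>e\<close> with right-hand side of lower degree.
\<close>

lemma eisenstein_polys_iff:
  "q \<in> eisenstein_polys R \<longleftrightarrow> (\<exists>ds. q = \<one> # ds \<and> length ds = ram_index R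
     \<and> set ds \<subseteq> carrier (coeff_ring R) \<and> set ds \<subseteq> PIdl\<^bsub>coeff_ring R\<^esub> (char_elem R)
     \<and> coeff (\<one> # ds) 0 \<in> PIdl\<^bsub>coeff_ring R\<^esub> (char_elem R)
     \<and> coeff (\<one> # ds) 0 \<notin> PIdl\<^bsub>coeff_ring R\<^esub> (char_elem R [^] (2::nat)))"
  (is "_ \<longleftrightarrow> (\<exists>ds. ?P ds)")
proof
  assume q: "q \<in> eisenstein_polys R"
  then have pol: "polynomial (carrier (coeff_ring R)) q"
    and deg: "length q - 1 = ram_index R" and top: "coeff q (ram_index R) = \<one>"
    and mid: "\<And>i. i < ram_index R \<Longrightarrow> coeff q i \<in> PIdl\<^bsub>coeff_ring R\<^esub> (char_elem R)"
    unfolding eisenstein_polys_def univ_poly_carrier by auto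
  have "q \<noteq> []" using top one_neq_zero by auto
  then obtain b ds where bds: "q = b # ds" by (cases q) auto
  have len: "length ds = ram_index R" using deg bds by simp
  have "b = \<one>" using top bds len by simp
  moreover have "set ds \<subseteq> PIdl\<^bsub>coeff_ring R\<^esub> (char_elem R)"
  proof
    fix d assume "d \<in> set ds"
    then obtain i where i: "i < length ds" "d = ds ! i" by (metis in_set_conv_nth)
    have "coeff q (length ds - 1 - i) = d"
      using i by (subst coeff_nth) (auto simp: bds nth_Cons')
    then show "d \<in> PIdl\<^bsub>coeff_ring R\<^esub> (char_elem R)" using mid[of "length ds - 1 - i"] i len by auto
  qed
  moreover have "set ds \<subseteq> carrier (coeff_ring R)" using polynomial_incl[OF pol] bds by auto
  moreover have "coeff q 0 \<in> PIdl\<^bsub>coeff_ring R\<^esub> (char_elem R)"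
    "coeff q 0 \<notin> PIdl\<^bsub>coeff_ring R\<^esub> (char_elem R [^] (2::nat))"
    using q unfolding eisenstein_polys_def by simp_all
  ultimately have "?P ds" using bds len by (simp del: coeff.simps)
  then show "\<exists>ds. ?P ds" by blast
next
  assume "\<exists>ds. ?P ds"
  then obtain ds where ds: "?P ds" by blast
  have "polynomial (carrier (coeff_ring R)) q"
    using ds one_neq_zero subringE(3)[OF coeff_subring] by (intro polynomialI) auto
  moreover have "coeff q i \<in> PIdl\<^bsub>coeff_ring R\<^esub> (char_elem R)" if "i < ram_index R" for i
  proof -
    have "coeff q i = ds ! (length ds - 1 - i)"
      using ds that by (subst coeff_nth) (auto simp: nth_Cons')
    moreover have "ds ! (length ds - 1 - i) \<in> set ds" using ds that by (intro nth_mem) auto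
    ultimately show ?thesis using ds by auto
  qed
  moreover have "coeff q 0 \<in> PIdl\<^bsub>coeff_ring R\<^esub> (char_elem R)"
    "coeff q 0 \<notin> PIdl\<^bsub>coeff_ring R\<^esub> (char_elem R [^] (2::nat))"
    using ds by blast+
  moreover have "length q - 1 = ram_index R" "coeff q (ram_index R) = \<one>"
    using ds by auto
  ultimately show "q \<in> eisenstein_polys R"
    unfolding eisenstein_polys_def univ_poly_carrier by blast
qed

lemma coeff_zero_snoc: "coeff (a # bs @ [g]) 0 = g"
  by (subst coeff_nth) auto

text \<open>
  Write \<open>p = w \<pi>\<^sup>e\<close> and expand the unit \<open>w\<^sup>-\<^sup>1\<close> as the value at \<open>\<pi>\<close> of a polynomial of degree below
  \<open>e\<close>. Then \<open>\<pi>\<^sup>e = p w\<^sup>-\<^sup>1\<close> is the desired equation. The constant term of the expansion is a unit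
  because \<open>w\<^sup>-\<^sup>1\<close> is, so \<open>p\<close> times it is not divisible by \<open>p\<^sup>2\<close>.
\<close>

lemma uniformizer_eisenstein_root:
  assumes u: "uniformizer R \<pi>" and ram: "ram_index R < nilpotency_index R"
  shows "\<exists>q\<in>eisenstein_polys R. eval q \<pi> = \<zero>"
proof -
  let ?K = "carrier (coeff_ring R)" and ?c = "char_elem R" and ?e = "ram_index R"
  note K = coeff_subring
  have c: "\<pi> \<in> carrier R" using u uniformizer_def by metis
  obtain w where w: "w \<in> Units R" "?c = w \<otimes> \<pi> [^] ?e"
    using char_elem_unit_times_power[OF u ram] by blast
  have "inv w \<in> eval_span ?K \<pi> ?e" using eval_span_uniformizer[OF u w] w(1) by simp
  then obtain ds where ds: "length ds = ?e" "set ds \<subseteq> ?K" "inv w = eval ds \<pi>"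
    unfolding eval_span_def by blast
  obtain bs g where bg: "ds = bs @ [g]"
    using ds(1) ram_index_pos[OF ram] by (metis length_0_conv neq0_conv rev_exhaust)
  have bc: "set bs \<subseteq> carrier R" "g \<in> ?K" "g \<in> carrier R" "eval bs \<pi> \<in> carrier R"
    using ds bg coeff_closed c by (auto intro!: eval_in_carrier)
  have iw: "inv w = g \<oplus> eval bs \<pi> \<otimes> \<pi>"
    using ds(3) bg eval_append_aux[OF bc(1,3) c] bc c by (simp add: a_comm)
  have gU: "g \<in> Units R"
  proof (rule ccontr)
    assume "g \<notin> Units R"
    then have "g \<in> max_ideal R" using bc Units_iff_notin_max by blast
    moreover have "eval bs \<pi> \<otimes> \<pi> \<in> max_ideal R" using max_ideal_mem_iff[OF u] bc by blast
    ultimately have "inv w \<in> max_ideal R"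
      unfolding iw by (rule additive_subgroup.a_closed[OF ideal.axioms(1)[OF max_ideal_ideal]])
    then show False using w(1) Units_iff_notin_max Units_inv_Units by blast
  qed
  let ?m = "\<lambda>d. (\<ominus> ?c) \<otimes> d"
  have mK: "\<ominus> ?c \<in> ?K" "\<ominus> ?c \<in> carrier R" using subringE(5)[OF K char_elem_coeff] char_elem_closed by auto
  have dc: "set ds \<subseteq> carrier R" using ds coeff_closed by auto
  have mem: "?m d \<in> ?K \<and> ?m d \<in> PIdl\<^bsub>coeff_ring R\<^esub> ?c" if "d \<in> ?K" for d
  proof -
    have "?m d = (\<ominus> d) \<otimes> ?c" using coeff_closed[OF that] char_elem_closed by algebra
    then show ?thesis
      using subringE(6)[OF K mK(1) that] subringE(5)[OF K that] unfolding coeff_PIdl_iff by blast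
  qed
  have "eval (map ?m ds) \<pi> = ?m (inv w)"
    using eval_map_mult[OF dc c mK(2)] ds(3) by simp
  also have "\<dots> = \<ominus> (\<pi> [^] ?e)"
  proof -
    have "?c \<otimes> inv w = \<pi> [^] ?e" unfolding w(2)
      using w(1) c Units_closed[OF w(1)] Units_inv_closed[OF w(1)] nat_pow_closed[OF c, of ?e]
      by (simp add: m_comm[of w] m_assoc)
    then show ?thesis using char_elem_closed w(1) by (simp add: l_minus)
  qed
  finally have "eval (\<one> # map ?m ds) \<pi> = \<zero>"
    using c ds(1) by (simp add: r_neg)
  moreover have "?m g \<notin> PIdl\<^bsub>coeff_ring R\<^esub> (?c [^] (2::nat))"
  proof
    assume "?m g \<in> PIdl\<^bsub>coeff_ring R\<^esub> (?c [^] (2::nat))"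
    then obtain z where z: "z \<in> ?K" "?m g = z \<otimes> ?c [^] (2::nat)" unfolding coeff_PIdl_iff by blast
    have zc: "z \<in> carrier R" using z coeff_closed by blast
    have "?c [^] (2::nat) = ?c \<otimes> ?c" using char_elem_closed by (simp add: numeral_2_eq_2)
    then have mz: "?m g = z \<otimes> (?c \<otimes> ?c)" using z(2) by simp
    have "?c \<otimes> (g \<oplus> z \<otimes> ?c) = \<ominus> (?m g) \<oplus> z \<otimes> (?c \<otimes> ?c)"
      using zc bc(3) char_elem_closed by algebra
    then have "?c \<otimes> (g \<oplus> z \<otimes> ?c) = \<zero>"
      unfolding mz using zc char_elem_closed by (simp add: l_neg)
    moreover have "z \<otimes> ?c \<in> max_ideal R"
      using char_elem_in_max zc ideal.I_l_closed[OF max_ideal_ideal] by simp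
    then have gz: "g \<oplus> z \<otimes> ?c \<in> Units R" using gU Units_plus_max_ideal by blast
    ultimately have "?c = \<zero>"
      using char_elem_closed Units_closed[OF gz] Units_l_cancel[OF gz char_elem_closed zero_closed]
      by (simp add: m_comm[of ?c])
    then show False using char_elem_nonzero[OF ram] by blast
  qed
  then have "\<one> # map ?m ds \<in> eisenstein_polys R"
    unfolding eisenstein_polys_iff
    using ds(1,2) mem bc(2) coeff_zero_snoc[of \<one> "map ?m bs" "?m g"] bg
    by (intro exI[of _ "map ?m ds"]) auto
  ultimately show ?thesis by blast
qed

text \<open>
  The equation reads \<open>x\<^sup>e = - p (z + y x)\<close> with \<open>p z\<close> the constant term of \<open>q\<close>, so that \<open>z\<close> is a
  unit. Hence \<open>x\<close> is in the maximal ideal, \<open>x\<^sup>e\<close> is a unit times \<open>p\<close>, and comparing orders gives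
  \<open>e \<cdot> ord x = e\<close>.
\<close>

lemma eisenstein_root_uniformizer:
  assumes q: "q \<in> eisenstein_polys R" and x: "x \<in> carrier R" and root: "eval q x = \<zero>"
    and ram: "ram_index R < nilpotency_index R"
  shows "uniformizer R x"
proof -
  let ?K = "carrier (coeff_ring R)" and ?c = "char_elem R" and ?e = "ram_index R"
  interpret P: ideal "max_ideal R" R by (rule max_ideal_ideal)
  obtain ds where ds: "q = \<one> # ds" "length ds = ?e" "set ds \<subseteq> ?K" "set ds \<subseteq> PIdl\<^bsub>coeff_ring R\<^esub> ?c"
    "coeff (\<one> # ds) 0 \<in> PIdl\<^bsub>coeff_ring R\<^esub> ?c"
    "coeff (\<one> # ds) 0 \<notin> PIdl\<^bsub>coeff_ring R\<^esub> (?c [^] (2::nat))"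
    using q unfolding eisenstein_polys_iff by blast
  obtain bs g where bg: "ds = bs @ [g]"
    using ds(2) ram_index_pos[OF ram] by (metis length_0_conv neq0_conv rev_exhaust)
  have incl: "PIdl\<^bsub>coeff_ring R\<^esub> ?c \<subseteq> PIdl ?c"
    unfolding subset_iff coeff_PIdl_iff PIdl_mem_iff using coeff_closed by blast
  have dc: "set bs \<subseteq> carrier R" "g \<in> carrier R" "eval bs x \<in> carrier R"
    using ds(3) bg coeff_closed x by (auto intro!: eval_in_carrier)
  have "eval bs x \<in> PIdl ?c"
    using eval_in_ideal[OF cgenideal_ideal[OF char_elem_closed] _ x] ds(4) bg incl by auto
  then obtain y where y: "y \<in> carrier R" "eval bs x = y \<otimes> ?c" unfolding PIdl_mem_iff by blast
  obtain z where z: "z \<in> ?K" "g = z \<otimes> ?c"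
    using ds(4) bg unfolding coeff_PIdl_iff by (auto simp: coeff_PIdl_iff)
  have zU: "z \<in> Units R"
  proof (rule ccontr)
    assume "z \<notin> Units R"
    then obtain z' where z': "z' \<in> ?K" "z = z' \<otimes> ?c" using coeff_unit_or_multiple z(1) by blast
    have "?c [^] (2::nat) = ?c \<otimes> ?c" using char_elem_closed by (simp add: numeral_2_eq_2)
    then have "g = z' \<otimes> ?c [^] (2::nat)"
      using z(2) z' coeff_closed char_elem_closed by (simp add: m_assoc)
    then show False using ds(6) bg coeff_zero_snoc[of \<one> bs g] z'(1) unfolding coeff_PIdl_iff by auto
  qed
  have zc: "z \<in> carrier R" using zU by (rule Units_closed)
  have "x [^] ?e \<oplus> (eval bs x \<otimes> x \<oplus> g) = \<zero>"
  proof -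
    have "x [^] ?e \<oplus> eval ds x = \<zero>" using root x unfolding ds(1) by (simp add: ds(2))
    then show ?thesis unfolding bg eval_append_aux[OF dc(1,2) x] .
  qed
  then have "x [^] ?e \<oplus> ((y \<otimes> ?c) \<otimes> x \<oplus> z \<otimes> ?c) = \<zero>" using y z by simp
  moreover have "b = (\<ominus> (z \<oplus> y \<otimes> x)) \<otimes> ?c"
    if "b \<oplus> ((y \<otimes> ?c) \<otimes> x \<oplus> z \<otimes> ?c) = \<zero>" "b \<in> carrier R" for b
  proof -
    have "b = (b \<oplus> ((y \<otimes> ?c) \<otimes> x \<oplus> z \<otimes> ?c)) \<oplus> (\<ominus> (z \<oplus> y \<otimes> x)) \<otimes> ?c"
      using that(2) y(1) zc x char_elem_closed by algebra
    then show ?thesis using that(1) y(1) zc x char_elem_closed by simp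
  qed
  ultimately have xe: "x [^] ?e = (\<ominus> (z \<oplus> y \<otimes> x)) \<otimes> ?c" using x by simp
  have xP: "x \<in> max_ideal R"
  proof (rule ccontr)
    assume "x \<notin> max_ideal R"
    then have "x \<in> Units R" using x Units_iff_notin_max by blast
    then have "x [^] ?e \<in> Units R" by (rule Units_pow_closed)
    moreover have "x [^] ?e \<in> max_ideal R"
      unfolding xe using char_elem_in_max y(1) zc x by (intro P.I_l_closed) auto
    ultimately show False using Units_iff_notin_max by blast
  qed
  obtain \<pi> where u: "uniformizer R \<pi>" using uniformizer_ex by blast
  have c: "\<pi> \<in> carrier R" using u uniformizer_def by metis
  obtain w where w: "w \<in> Units R" "?c = w \<otimes> \<pi> [^] ?e"
    using char_elem_unit_times_power[OF u ram] by blast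
  have "y \<otimes> x \<in> max_ideal R" using xP y(1) by (intro P.I_l_closed)
  then have "z \<oplus> y \<otimes> x \<in> Units R" using zU Units_plus_max_ideal by blast
  then have "z \<oplus> y \<otimes> x \<in> carrier R" "z \<oplus> y \<otimes> x \<notin> max_ideal R"
    unfolding Units_iff_notin_max by auto
  then have vU: "\<ominus> (z \<oplus> y \<otimes> x) \<in> Units R"
    unfolding Units_iff_notin_max using P.a_inv_closed[of "\<ominus> (z \<oplus> y \<otimes> x)"] by auto
  have xe': "x [^] ?e = (\<ominus> (z \<oplus> y \<otimes> x) \<otimes> w) \<otimes> \<pi> [^] ?e"
    unfolding xe w(2) using Units_closed[OF vU] Units_closed[OF w(1)] c by (intro m_assoc[symmetric]) auto
  have vw: "\<ominus> (z \<oplus> y \<otimes> x) \<otimes> w \<in> Units R" using vU w(1) by (rule Units_m_closed)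
  have xe0: "x [^] ?e \<noteq> \<zero>"
  proof
    assume "x [^] ?e = \<zero>"
    then have "\<pi> [^] ?e = \<zero>"
      unfolding xe' using Units_l_cancel[OF vw nat_pow_closed[OF c] zero_closed] Units_closed[OF vw] by simp
    then show False using uniformizer_pow_eq_zero_iff[OF u, of ?e] ram by simp
  qed
  obtain s n where s: "s \<in> Units R" "x = s \<otimes> \<pi> [^] (n::nat)"
    using unit_times_uniformizer_power[OF u x] by blast
  have "x [^] ?e = s [^] ?e \<otimes> \<pi> [^] (n * ?e)"
    using s(2) c Units_closed[OF s(1)] by (simp add: nat_pow_distrib nat_pow_pow)
  then have "ord_max R (x [^] ?e) = n * ?e"
    using ord_max_unit_times_power[OF u Units_pow_closed[OF s(1)] _ xe0] by blast
  moreover have "ord_max R (x [^] ?e) = ?e"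
    using ord_max_unit_times_power[OF u vw xe' xe0] .
  ultimately have "n = 1" using ram_index_pos[OF ram] by simp
  then have xs: "x = s \<otimes> \<pi>" using s c by simp
  have "max_ideal R = PIdl x"
  proof
    show "PIdl x \<subseteq> max_ideal R" using cgenideal_minimal[OF max_ideal_ideal xP] .
    show "max_ideal R \<subseteq> PIdl x"
    proof
      fix b assume "b \<in> max_ideal R"
      then obtain r where r: "r \<in> carrier R" "b = r \<otimes> \<pi>" using max_ideal_mem_iff[OF u] by blast
      have "\<pi> = inv s \<otimes> x" using xs s(1) c Units_closed[OF s(1)] by (simp add: m_assoc[symmetric])
      then have "b = (r \<otimes> inv s) \<otimes> x" using r s(1) x by (simp add: m_assoc)
      then show "b \<in> PIdl x" using r s(1) unfolding PIdl_mem_iff by blast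
    qed
  qed
  then show ?thesis unfolding uniformizer_def using x by blast
qed

end

section \<open>Products of rings and graphs of isomorphisms\<close>

lemma RDirProd_ops [simp]:
  "carrier (RDirProd R S) = carrier R \<times> carrier S"
  "\<one>\<^bsub>RDirProd R S\<^esub> = (\<one>\<^bsub>R\<^esub>, \<one>\<^bsub>S\<^esub>)"
  "\<zero>\<^bsub>RDirProd R S\<^esub> = (\<zero>\<^bsub>R\<^esub>, \<zero>\<^bsub>S\<^esub>)"
  "(a, b) \<otimes>\<^bsub>RDirProd R S\<^esub> (c, d) = (a \<otimes>\<^bsub>R\<^esub> c, b \<otimes>\<^bsub>S\<^esub> d)"
  "(a, b) \<oplus>\<^bsub>RDirProd R S\<^esub> (c, d) = (a \<oplus>\<^bsub>R\<^esub> c, b \<oplus>\<^bsub>S\<^esub> d)"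
  unfolding RDirProd_def DirProd_def by (simp_all add: monoid.defs)

lemma RDirProd_pow [simp]:
  "(a, b) [^]\<^bsub>RDirProd R S\<^esub> (n::nat) = (a [^]\<^bsub>R\<^esub> n, b [^]\<^bsub>S\<^esub> n)"
  by (induction n) auto

lemma RDirProd_cring:
  assumes "cring R" "cring S"
  shows "cring (RDirProd R S)"
proof -
  interpret R: cring R by fact
  interpret S: cring S by fact
  interpret P: ring "RDirProd R S" using RDirProd_ring R.ring_axioms S.ring_axioms by blast
  show ?thesis
    by (rule cring.intro[OF P.ring_axioms], rule P.monoid_comm_monoidI)
      (auto simp: R.m_comm S.m_comm)
qed

lemma RDirProd_Units:
  assumes "a \<in> Units R" "b \<in> Units S"
  shows "(a, b) \<in> Units (RDirProd R S)"
  using assms unfolding Units_def by fastforce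

lemma RDirProd_Units_D:
  assumes "(a, b) \<in> Units (RDirProd R S)"
  shows "a \<in> Units R" "b \<in> Units S"
  using assms unfolding Units_def by fastforce+

lemma RDirProd_a_inv:
  assumes "ring R" "ring S" "a \<in> carrier R" "b \<in> carrier S"
  shows "\<ominus>\<^bsub>RDirProd R S\<^esub> (a, b) = (\<ominus>\<^bsub>R\<^esub> a, \<ominus>\<^bsub>S\<^esub> b)"
proof -
  interpret R: ring R by fact
  interpret S: ring S by fact
  interpret P: ring "RDirProd R S" using RDirProd_ring assms by blast
  show ?thesis
    using assms(3,4) by (intro P.minus_equality) (auto simp: R.l_neg S.l_neg)
qed

lemma RDirProd_eval:
  assumes "ring R" "ring S" "set gs \<subseteq> carrier R \<times> carrier S" "x \<in> carrier R" "y \<in> carrier S"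
  shows "ring.eval (RDirProd R S) gs (x, y) = (ring.eval R (map fst gs) x, ring.eval S (map snd gs) y)"
proof -
  interpret R: ring R by fact
  interpret S: ring S by fact
  interpret P: ring "RDirProd R S" using RDirProd_ring assms by blast
  show ?thesis using assms(3) by (induction gs) auto
qed

text \<open>
  The condition on zeros, applied to differences, says that the relation \<open>T\<close> is single-valued
  and injective.
\<close>

lemma iso_of_graph:
  assumes R: "ring R" and S: "ring S" and T: "subring T (RDirProd R S)"
    and total: "\<And>x. x \<in> carrier R \<Longrightarrow> \<exists>y. (x, y) \<in> T"
    and surj: "\<And>y. y \<in> carrier S \<Longrightarrow> \<exists>x. (x, y) \<in> T"
    and zero: "\<And>x y. (x, y) \<in> T \<Longrightarrow> x = \<zero>\<^bsub>R\<^esub> \<longleftrightarrow> y = \<zero>\<^bsub>S\<^esub>"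
  shows "R \<simeq> S"
proof -
  interpret R: ring R by fact
  interpret S: ring S by fact
  have Tc: "x \<in> carrier R" "y \<in> carrier S" if "(x, y) \<in> T" for x y
    using subringE(1)[OF T] that by auto
  have diff: "(x \<ominus>\<^bsub>R\<^esub> x', y \<ominus>\<^bsub>S\<^esub> y') \<in> T" if "(x, y) \<in> T" "(x', y') \<in> T" for x y x' y'
  proof -
    have "(x, y) \<oplus>\<^bsub>RDirProd R S\<^esub> (\<ominus>\<^bsub>RDirProd R S\<^esub> (x', y')) \<in> T"
      by (rule subringE(7)[OF T that(1) subringE(5)[OF T that(2)]])
    then show ?thesis
      using RDirProd_a_inv[OF R S Tc[OF that(2)]] by (simp add: a_minus_def)
  qed
  have uniq: "x = x' \<longleftrightarrow> y = y'" if "(x, y) \<in> T" "(x', y') \<in> T" for x y x' y'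
    using zero[OF diff[OF that]] Tc[OF that(1)] Tc[OF that(2)] by simp
  define \<phi> where "\<phi> x = (SOME y. (x, y) \<in> T)" for x
  have \<phi>: "(x, \<phi> x) \<in> T" if "x \<in> carrier R" for x
    unfolding \<phi>_def using someI_ex[OF total[OF that]] .
  have \<phi>_eq: "\<phi> x = y" if "(x, y) \<in> T" for x y
    using uniq[OF \<phi>[OF Tc(1)[OF that]] that] by simp
  have "\<phi> \<in> ring_iso R S"
  proof (rule ring_iso_memI)
    show "\<phi> x \<in> carrier S" if "x \<in> carrier R" for x using Tc \<phi>[OF that] by blast
    show "\<phi> (x \<otimes>\<^bsub>R\<^esub> y) = \<phi> x \<otimes>\<^bsub>S\<^esub> \<phi> y" if "x \<in> carrier R" "y \<in> carrier R" for x y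
      using subringE(6)[OF T \<phi>[OF that(1)] \<phi>[OF that(2)]] by (intro \<phi>_eq) simp
    show "\<phi> (x \<oplus>\<^bsub>R\<^esub> y) = \<phi> x \<oplus>\<^bsub>S\<^esub> \<phi> y" if "x \<in> carrier R" "y \<in> carrier R" for x y
      using subringE(7)[OF T \<phi>[OF that(1)] \<phi>[OF that(2)]] by (intro \<phi>_eq) simp
    show "\<phi> \<one>\<^bsub>R\<^esub> = \<one>\<^bsub>S\<^esub>" using subringE(3)[OF T] by (intro \<phi>_eq) simp
    show "bij_betw \<phi> (carrier R) (carrier S)"
    proof (rule bij_betw_imageI)
      show "inj_on \<phi> (carrier R)" using uniq \<phi> by (intro inj_onI) metis
      show "\<phi> ` carrier R = carrier S"
      proof
        show "\<phi> ` carrier R \<subseteq> carrier S" using Tc \<phi> by blast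
        show "carrier S \<subseteq> \<phi> ` carrier R"
        proof
          fix y assume "y \<in> carrier S"
          then obtain x where "(x, y) \<in> T" using surj by blast
          then show "y \<in> \<phi> ` carrier R" using \<phi>_eq Tc by blast
        qed
      qed
    qed
  qed
  then show ?thesis unfolding is_ring_iso_def by blast
qed

section \<open>Determination of the ring by its signature\<close>

theorem theorem2:
  fixes R :: "('a, 'm) ring_scheme" and R' :: "('b, 'n) ring_scheme"
    and \<sigma> :: "'a \<Rightarrow> 'b" and a e f p :: nat
  assumes "finite_local_pir R" and "finite_local_pir R'"
    and "lpir_type R = (a, e, f, p)" and "lpir_type R' = (a, e, f, p)"
    and "e < a"
    and "\<sigma> \<in> ring_iso (coeff_ring R) (coeff_ring R')"
    and "map \<sigma> ` Delta R = Delta R'"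
  shows "R \<simeq> R'"
proof -
  interpret R: finite_local_pir R by fact
  interpret R': finite_local_pir R' by fact
  define S where "S = RDirProd R R'"
  interpret S: cring S
    unfolding S_def by (rule RDirProd_cring[OF R.cring_axioms R'.cring_axioms])
  let ?K = "carrier (coeff_ring R)" and ?K' = "carrier (coeff_ring R')"
  let ?c = "char_elem R" and ?c' = "char_elem R'"
  have type: "nilpotency_index R = a" "nilpotency_index R' = a" "ram_index R = e"
    "ram_index R' = e" "residue_char R = p" "residue_char R' = p"
    using assms(3,4) unfolding lpir_type_def by auto
  have ram: "ram_index R < nilpotency_index R" "ram_index R' < nilpotency_index R'"
    using assms(5) type by auto
  have e_pos: "0 < e" using R.ram_index_pos[OF ram(1)] type by simp

  have \<sigma>_bij: "bij_betw \<sigma> ?K ?K'" and \<sigma>_hom: "\<sigma> \<in> ring_hom (coeff_ring R) (coeff_ring R')"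
    using assms(6) unfolding ring_iso_def by auto
  have \<sigma>_closed: "\<sigma> x \<in> ?K'" if "x \<in> ?K" for x
    using ring_hom_closed[OF \<sigma>_hom that] .
  have \<sigma>_mult: "\<sigma> (x \<otimes>\<^bsub>R\<^esub> y) = \<sigma> x \<otimes>\<^bsub>R'\<^esub> \<sigma> y" if "x \<in> ?K" "y \<in> ?K" for x y
    using ring_hom_mult[OF \<sigma>_hom that] by simp
  have \<sigma>_add: "\<sigma> (x \<oplus>\<^bsub>R\<^esub> y) = \<sigma> x \<oplus>\<^bsub>R'\<^esub> \<sigma> y" if "x \<in> ?K" "y \<in> ?K" for x y
    using ring_hom_add[OF \<sigma>_hom that] by simp
  have \<sigma>_one: "\<sigma> \<one>\<^bsub>R\<^esub> = \<one>\<^bsub>R'\<^esub>"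
    using ring_hom_one[OF \<sigma>_hom] by simp
  interpret \<sigma>: ring_hom_ring "coeff_ring R" "coeff_ring R'" \<sigma>
    using ring_hom_ringI2[OF _ _ \<sigma>_hom] R.coeff_ring_cring R'.coeff_ring_cring
    unfolding cring_def by blast
  have \<sigma>_zero: "\<sigma> \<zero>\<^bsub>R\<^esub> = \<zero>\<^bsub>R'\<^esub>" using \<sigma>.hom_zero by simp
  have \<sigma>_pow: "\<sigma> (x [^]\<^bsub>R\<^esub> n) = \<sigma> x [^]\<^bsub>R'\<^esub> n" if "x \<in> ?K" for x and n :: nat
    using \<sigma>.hom_nat_pow[OF that, of n] by simp
  have \<sigma>_nat: "[n] \<cdot>\<^bsub>R\<^esub> \<one>\<^bsub>R\<^esub> \<in> ?K \<and> \<sigma> ([n] \<cdot>\<^bsub>R\<^esub> \<one>\<^bsub>R\<^esub>) = [n] \<cdot>\<^bsub>R'\<^esub> \<one>\<^bsub>R'\<^esub>" for n :: nat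
    using subringE(3)[OF R.coeff_subring]
    by (induction n)
      (auto simp: \<sigma>_zero \<sigma>_one \<sigma>_add intro: subringE(2,3,7)[OF R.coeff_subring])
  have \<sigma>_char: "\<sigma> ?c = ?c'"
    using \<sigma>_nat unfolding char_elem_def type by blast
  \<comment> \<open>an element of the coefficient ring is a unit iff it is not a multiple of \<open>p\<close>, and \<open>\<sigma>\<close> maps \<open>p\<close> to \<open>p\<close>\<close>
  have \<sigma>_unit: "\<sigma> u \<in> Units R'" if u: "u \<in> Units R" "u \<in> ?K" for u
  proof (rule ccontr)
    assume "\<sigma> u \<notin> Units R'"
    then obtain z' where z': "z' \<in> ?K'" "\<sigma> u = z' \<otimes>\<^bsub>R'\<^esub> ?c'"
      using R'.coeff_unit_or_multiple[OF \<sigma>_closed[OF u(2)]] by blast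
    obtain z where z: "z \<in> ?K" "z' = \<sigma> z"
      using \<sigma>_bij z'(1) unfolding bij_betw_def by blast
    have "\<sigma> u = \<sigma> (z \<otimes>\<^bsub>R\<^esub> ?c)"
      using z'(2) z \<sigma>_mult[OF z(1) R.char_elem_coeff] \<sigma>_char by simp
    then have "u = z \<otimes>\<^bsub>R\<^esub> ?c"
      using \<sigma>_bij u(2) subringE(6)[OF R.coeff_subring z(1) R.char_elem_coeff]
      unfolding bij_betw_def inj_on_def by blast
    then show False
      using R.coeff_unit_iff[OF u(2)] u(1) z(1) R.coeff_PIdl_iff by blast
  qed

  obtain \<pi> where \<pi>: "uniformizer R \<pi>" using R.uniformizer_ex by blast
  then have \<pi>c: "\<pi> \<in> carrier R" unfolding uniformizer_def by blast
  obtain q where q: "q \<in> eisenstein_polys R" "R.eval q \<pi> = \<zero>\<^bsub>R\<^esub>"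
    using R.uniformizer_eisenstein_root[OF \<pi> ram(1)] by blast
  then have "map \<sigma> q \<in> Delta R'" using assms(7) \<pi>c unfolding Delta_def[of R] by blast
  then obtain \<pi>' where q': "map \<sigma> q \<in> eisenstein_polys R'"
    and \<pi>'c: "\<pi>' \<in> carrier R'" and root': "R'.eval (map \<sigma> q) \<pi>' = \<zero>\<^bsub>R'\<^esub>"
    unfolding Delta_def by blast
  have \<pi>': "uniformizer R' \<pi>'"
    by (rule R'.eisenstein_root_uniformizer[OF q' \<pi>'c root' ram(2)])
  obtain w where w: "w \<in> Units R" "?c = w \<otimes>\<^bsub>R\<^esub> \<pi> [^]\<^bsub>R\<^esub> e"
    using R.char_elem_unit_times_power[OF \<pi> ram(1)] type by auto
  obtain w' where w': "w' \<in> Units R'" "?c' = w' \<otimes>\<^bsub>R'\<^esub> \<pi>' [^]\<^bsub>R'\<^esub> e"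
    using R'.char_elem_unit_times_power[OF \<pi>' ram(2)] type by auto

  \<comment> \<open>the graph of \<open>\<sigma>\<close> and the pair of uniformizers, in the product ring\<close>
  define G where "G = (\<lambda>c. (c, \<sigma> c)) ` ?K"
  define \<tau> where "\<tau> = (\<pi>, \<pi>')"
  have \<tau>c: "\<tau> \<in> carrier S" unfolding \<tau>_def S_def using \<pi>c \<pi>'c by simp
  have Gc: "G \<subseteq> carrier S"
    unfolding G_def S_def using R.coeff_closed R'.coeff_closed \<sigma>_closed by auto
  have G: "subring G S"
  proof (rule S.subringI[OF Gc])
    show "\<one>\<^bsub>S\<^esub> \<in> G"
      unfolding G_def S_def using \<sigma>_one subringE(3)[OF R.coeff_subring] by force
    fix x y assume "x \<in> G" "y \<in> G"
    then obtain c d where cd: "c \<in> ?K" "d \<in> ?K" "x = (c, \<sigma> c)" "y = (d, \<sigma> d)"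
      unfolding G_def by blast
    show "x \<oplus>\<^bsub>S\<^esub> y \<in> G"
      using cd \<sigma>_add[OF cd(1,2)] subringE(7)[OF R.coeff_subring cd(1,2)]
      unfolding G_def S_def by force
    show "x \<otimes>\<^bsub>S\<^esub> y \<in> G"
      using cd \<sigma>_mult[OF cd(1,2)] subringE(6)[OF R.coeff_subring cd(1,2)]
      unfolding G_def S_def by force
  next
    fix x assume "x \<in> G"
    then obtain c where c: "c \<in> ?K" "x = (c, \<sigma> c)" unfolding G_def by blast
    have m: "\<ominus>\<^bsub>R\<^esub> c \<in> ?K" using subringE(5)[OF R.coeff_subring c(1)] .
    have "\<sigma> c \<oplus>\<^bsub>R'\<^esub> \<sigma> (\<ominus>\<^bsub>R\<^esub> c) = \<zero>\<^bsub>R'\<^esub>"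
      using \<sigma>_add[OF c(1) m] \<sigma>_zero R.r_neg[OF R.coeff_closed[OF c(1)]] by simp
    then have "\<ominus>\<^bsub>R'\<^esub> \<sigma> c = \<sigma> (\<ominus>\<^bsub>R\<^esub> c)"
      using R'.minus_equality[of "\<sigma> (\<ominus>\<^bsub>R\<^esub> c)" "\<sigma> c"] R'.a_comm
        R'.coeff_closed[OF \<sigma>_closed[OF m]] R'.coeff_closed[OF \<sigma>_closed[OF c(1)]] by simp
    then have "\<ominus>\<^bsub>S\<^esub> x = (\<ominus>\<^bsub>R\<^esub> c, \<sigma> (\<ominus>\<^bsub>R\<^esub> c))"
      unfolding S_def c(2)
      using RDirProd_a_inv[OF R.ring_axioms R'.ring_axioms R.coeff_closed[OF c(1)]
          R'.coeff_closed[OF \<sigma>_closed[OF c(1)]]] by simp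
    then show "\<ominus>\<^bsub>S\<^esub> x \<in> G" unfolding G_def using m by blast
  qed
  have eval_G: "S.eval (map (\<lambda>c. (c, \<sigma> c)) cs) \<tau> = (R.eval cs \<pi>, R'.eval (map \<sigma> cs) \<pi>')"
    if "set cs \<subseteq> ?K" for cs
  proof -
    have "set (map (\<lambda>c. (c, \<sigma> c)) cs) \<subseteq> carrier R \<times> carrier R'"
      using that \<sigma>_closed R.coeff_closed R'.coeff_closed by auto
    then show ?thesis
      unfolding S_def \<tau>_def
      using RDirProd_eval[OF R.ring_axioms R'.ring_axioms _ \<pi>c \<pi>'c] by (simp add: comp_def)
  qed
  have span_G: "(R.eval cs \<pi>, R'.eval (map \<sigma> cs) \<pi>') \<in> S.eval_span G \<tau> e"
    if "set cs \<subseteq> ?K" "length cs = e" for cs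
  proof -
    have "set (map (\<lambda>c. (c, \<sigma> c)) cs) \<subseteq> G" using that(1) unfolding G_def by auto
    then show ?thesis
      unfolding S.eval_span_def eval_G[OF that(1), symmetric] using that(2)
      by (intro CollectI exI[of _ "map (\<lambda>c. (c, \<sigma> c)) cs"]) simp
  qed

  \<comment> \<open>\<open>\<pi>\<close> is a zero of \<open>q\<close> and \<open>\<pi>'\<close> one of its image, so the pair is a zero of a monic polynomial over \<open>G\<close>\<close>
  have \<tau>e: "\<tau> [^]\<^bsub>S\<^esub> e \<in> S.eval_span G \<tau> e"
  proof -
    obtain ds where ds: "q = \<one>\<^bsub>R\<^esub> # ds" "length ds = e" "set ds \<subseteq> ?K"
      using q(1) unfolding R.eisenstein_polys_iff type by blast
    have dsG: "(R.eval ds \<pi>, R'.eval (map \<sigma> ds) \<pi>') \<in> S.eval_span G \<tau> e"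
      by (rule span_G[OF ds(3,2)])
    have c: "R.eval ds \<pi> \<in> carrier R" "R'.eval (map \<sigma> ds) \<pi>' \<in> carrier R'"
      using S.eval_span_carrier[OF G \<tau>c dsG] unfolding S_def by auto
    have "\<pi> [^]\<^bsub>R\<^esub> e \<oplus>\<^bsub>R\<^esub> R.eval ds \<pi> = \<zero>\<^bsub>R\<^esub>"
      using q(2) \<pi>c unfolding ds(1) by (simp add: ds(2))
    moreover have "\<pi>' [^]\<^bsub>R'\<^esub> e \<oplus>\<^bsub>R'\<^esub> R'.eval (map \<sigma> ds) \<pi>' = \<zero>\<^bsub>R'\<^esub>"
      using root' \<pi>'c unfolding ds(1) by (simp add: ds(2) \<sigma>_one)
    ultimately have "\<tau> [^]\<^bsub>S\<^esub> e = \<ominus>\<^bsub>S\<^esub> (R.eval ds \<pi>, R'.eval (map \<sigma> ds) \<pi>')"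
      using c \<pi>c \<pi>'c R.minus_equality R'.minus_equality
        RDirProd_a_inv[OF R.ring_axioms R'.ring_axioms c]
      unfolding \<tau>_def S_def by simp
    then show ?thesis using S.eval_span_neg[OF G \<tau>c dsG] by simp
  qed
  have T: "subring (S.eval_span G \<tau> e) S"
    by (rule S.eval_span_subring[OF G \<tau>c e_pos \<tau>e])

  have unit_add: "u \<oplus>\<^bsub>S\<^esub> r \<otimes>\<^bsub>S\<^esub> \<tau> \<in> Units S" if ur: "u \<in> Units S" "r \<in> carrier S" for u r
  proof -
    obtain u1 u2 r1 r2 where split: "u = (u1, u2)" "r = (r1, r2)" by (cases u, cases r)
    have "u1 \<in> Units R" "u2 \<in> Units R'" "r1 \<in> carrier R" "r2 \<in> carrier R'"
      using ur RDirProd_Units_D[of u1 u2 R R'] unfolding split S_def by simp_all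
    moreover have "r1 \<otimes>\<^bsub>R\<^esub> \<pi> \<in> max_ideal R" "r2 \<otimes>\<^bsub>R'\<^esub> \<pi>' \<in> max_ideal R'"
      using calculation(3,4) R.max_ideal_mem_iff[OF \<pi>] R'.max_ideal_mem_iff[OF \<pi>'] by blast+
    ultimately show ?thesis
      unfolding split \<tau>_def S_def
      by (simp add: RDirProd_Units R.Units_plus_max_ideal R'.Units_plus_max_ideal)
  qed
  \<comment> \<open>\<open>d = u p\<^sup>j\<close> with \<open>p = w \<pi>\<^sup>e\<close> gives \<open>d = (u w\<^sup>j) \<pi>\<^sup>e\<^sup>j\<close>, and \<open>\<sigma>\<close> turns this into the same
    exponent on the other side\<close>
  have val: "\<exists>u\<in>Units S. \<exists>j. g = u \<otimes>\<^bsub>S\<^esub> \<tau> [^]\<^bsub>S\<^esub> (e * j)" if g: "g \<in> G" for g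
  proof -
    obtain d where d: "d \<in> ?K" "g = (d, \<sigma> d)" using g by (auto simp: G_def)
    obtain u j where u: "u \<in> Units R" "u \<in> ?K" "d = u \<otimes>\<^bsub>R\<^esub> ?c [^]\<^bsub>R\<^esub> (j::nat)"
      using R.coeff_unit_times_char_power[OF d(1)] by blast
    have cK: "?c [^]\<^bsub>R\<^esub> j \<in> ?K"
      using \<sigma>.R.nat_pow_closed[OF R.char_elem_coeff, of j] by simp
    have \<sigma>d: "\<sigma> d = \<sigma> u \<otimes>\<^bsub>R'\<^esub> ?c' [^]\<^bsub>R'\<^esub> j"
      unfolding u(3) \<sigma>_mult[OF u(2) cK] \<sigma>_pow[OF R.char_elem_coeff] \<sigma>_char ..
    define v v' where "v = u \<otimes>\<^bsub>R\<^esub> w [^]\<^bsub>R\<^esub> j" and "v' = \<sigma> u \<otimes>\<^bsub>R'\<^esub> w' [^]\<^bsub>R'\<^esub> j"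
    have vU: "v \<in> Units R" "v' \<in> Units R'"
      unfolding v_def v'_def using u \<sigma>_unit w(1) w'(1)
      by (auto intro: R.Units_m_closed R'.Units_m_closed R.Units_pow_closed R'.Units_pow_closed)
    have "d = v \<otimes>\<^bsub>R\<^esub> \<pi> [^]\<^bsub>R\<^esub> (e * j)"
      unfolding u(3) w(2) v_def using R.Units_closed[OF u(1)] R.Units_closed[OF w(1)] \<pi>c
      by (simp add: R.nat_pow_distrib R.nat_pow_pow R.m_assoc)
    moreover have "\<sigma> d = v' \<otimes>\<^bsub>R'\<^esub> \<pi>' [^]\<^bsub>R'\<^esub> (e * j)"
      unfolding \<sigma>d w'(2) v'_def
      using R'.Units_closed[OF \<sigma>_unit[OF u(1,2)]] R'.Units_closed[OF w'(1)] \<pi>'c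
      by (simp add: R'.nat_pow_distrib R'.nat_pow_pow R'.m_assoc)
    ultimately have "g = (v, v') \<otimes>\<^bsub>S\<^esub> \<tau> [^]\<^bsub>S\<^esub> (e * j)"
      unfolding d(2) \<tau>_def S_def by simp
    moreover have "(v, v') \<in> Units S" unfolding S_def using vU by (rule RDirProd_Units)
    ultimately show ?thesis by blast
  qed
  have zero: "x = \<zero>\<^bsub>R\<^esub> \<longleftrightarrow> y = \<zero>\<^bsub>R'\<^esub>" if xy: "(x, y) \<in> S.eval_span G \<tau> e" for x y
  proof -
    consider "(x, y) = \<zero>\<^bsub>S\<^esub>" | u n where "u \<in> Units S" "(x, y) = u \<otimes>\<^bsub>S\<^esub> \<tau> [^]\<^bsub>S\<^esub> (n::nat)"
      using S.eval_span_unit_times_power[OF G \<tau>c unit_add _ order_refl xy] val by blast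
    then show ?thesis
    proof cases
      case 1
      then show ?thesis unfolding S_def by simp
    next
      case 2
      obtain u1 u2 where split: "u = (u1, u2)" by (cases u)
      have U: "u1 \<in> Units R" "u2 \<in> Units R'"
        using RDirProd_Units_D[of u1 u2 R R'] 2(1) unfolding split S_def by blast+
      have eq: "x = u1 \<otimes>\<^bsub>R\<^esub> \<pi> [^]\<^bsub>R\<^esub> n" "y = u2 \<otimes>\<^bsub>R'\<^esub> \<pi>' [^]\<^bsub>R'\<^esub> n"
        using 2(2) unfolding split \<tau>_def S_def by auto
      have "x = \<zero>\<^bsub>R\<^esub> \<longleftrightarrow> \<pi> [^]\<^bsub>R\<^esub> n = \<zero>\<^bsub>R\<^esub>"
        unfolding eq using R.Units_l_cancel[OF U(1) R.nat_pow_closed[OF \<pi>c] R.zero_closed]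
          R.Units_closed[OF U(1)] by auto
      also have "\<dots> \<longleftrightarrow> a \<le> n"
        using R.uniformizer_pow_eq_zero_iff[OF \<pi>] type by simp
      also have "\<dots> \<longleftrightarrow> \<pi>' [^]\<^bsub>R'\<^esub> n = \<zero>\<^bsub>R'\<^esub>"
        using R'.uniformizer_pow_eq_zero_iff[OF \<pi>'] type by simp
      also have "\<dots> \<longleftrightarrow> y = \<zero>\<^bsub>R'\<^esub>"
        unfolding eq using R'.Units_l_cancel[OF U(2) R'.nat_pow_closed[OF \<pi>'c] R'.zero_closed]
          R'.Units_closed[OF U(2)] by auto
      finally show ?thesis .
    qed
  qed
  show ?thesis
  proof (rule iso_of_graph[OF R.ring_axioms R'.ring_axioms T[unfolded S_def]])
    fix x assume "x \<in> carrier R"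
    then obtain cs where "length cs = e" "set cs \<subseteq> ?K" "x = R.eval cs \<pi>"
      using R.eval_span_uniformizer[OF \<pi> w] unfolding R.eval_span_def by blast
    then show "\<exists>y. (x, y) \<in> ring.eval_span (RDirProd R R') G \<tau> e"
      using span_G unfolding S_def by blast
  next
    fix y assume "y \<in> carrier R'"
    then obtain cs' where cs': "length cs' = e" "set cs' \<subseteq> ?K'" "y = R'.eval cs' \<pi>'"
      using R'.eval_span_uniformizer[OF \<pi>' w'] unfolding R'.eval_span_def by blast
    define cs where "cs = map (inv_into ?K \<sigma>) cs'"
    have inv: "inv_into ?K \<sigma> c \<in> ?K \<and> \<sigma> (inv_into ?K \<sigma> c) = c" if "c \<in> set cs'" for c
      using that cs'(2) bij_betw_inv_into_right[OF \<sigma>_bij] bij_betw_apply[OF bij_betw_inv_into[OF \<sigma>_bij]]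
      by (simp add: subset_iff)
    have "map \<sigma> cs = cs'"
      unfolding cs_def map_map using inv by (intro map_idI) simp
    moreover have "set cs \<subseteq> ?K" "length cs = e"
      unfolding cs_def using inv cs'(1) by auto
    ultimately show "\<exists>x. (x, y) \<in> ring.eval_span (RDirProd R R') G \<tau> e"
      using span_G cs'(3) unfolding S_def by blast
  next
    fix x y assume "(x, y) \<in> ring.eval_span (RDirProd R R') G \<tau> e"
    then show "x = \<zero>\<^bsub>R\<^esub> \<longleftrightarrow> y = \<zero>\<^bsub>R'\<^esub>" using zero unfolding S_def by blast
  qed
qed

end
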